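(* Let $G$ be a compact, totally disconnected, and metrizable topological group. Then the spectral dimension of $G$, i.e. $\mathcal{S}dim(C(G),G,\Delta)$, is equal to $0$.
   Context: Spectral dimension: for a compact group $G$, let $\Delta:C(G)\to C(G)\otimes C(G)=C(G\times G)$, $\Delta(f)(x,y)=f(xy)$; $(C(G),G,\Delta)$ is the canonical ergodic $C^*$-dynamical system, whose invariant state is given by the Haar measure. Let $\mathcal{O}(G)\subseteq C(G)$ be the dense $*$-subalgebra generated by matrix entries of irreducible unitary representations, and $\mathcal{A}=\{f\in C(G):\Delta(f)\in C(G)\otimes_{alg}\mathcal{O}(G)\}$. Let $\pi$ be the representation of $C(G)$ on $L^2(G)$ (Haar measure) by multiplication, and $R$ the right regular representation $(R_xf)(y)=f(yx)$; $(\pi,R)$ is the covariant representation associated with the invariant state. Let $\mathcal{E}$ be the class of spectral triples $(L^2(G),\pi,D)$ for $\mathcal{A}$ (that is, $D$ is a self-adjoint operator with compact resolvent on $L^2(G)$ and $[D,\pi(f)]$ extends to a bounded operator for every $f\in\mathcal{A}$) that are equivariant, i.e. $D$ commutes with $R_x$ for all $x\in G$. $D$ is $s$-summable if $\mathrm{Tr}\,|D|^{-s}<\infty$ (with $|D|^{-s}$ taken to be $0$ on $\ker D$). Then $$\mathcal{S}dim(C(G),G,\Delta)=\inf\{s>0:\exists\, D \text{ such that } (L^2(G),\pi,D)\in\mathcal{E}\text{ and } D \text{ is } s\text{-summable}\}.$$ *)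

theory Defs
  imports "HOL-Probability.Probability_Measure" "Jordan_Normal_Form.Schur_Decomposition"
begin

text \<open>
  A topological group is a type of the library class \<^class>\<open>topological_group_add\<close>. The group
  operation is written additively but is not assumed to be commutative; the product \<open>x y\<close> of the
  multiplicative notation is \<open>x + y\<close>. Compactness of the group is the hypothesis
  \<open>compact UNIV\<close> of the theorem, and everything below is meant for compact groups.
\<close>

section \<open>Haar measure\<close>

text \<open>
  On a compact Hausdorff group there is exactly one measure with the following properties. Since
  the measure is finite, outer regularity on Borel sets already gives inner regularity, by passing
  to complements.
\<close>

definition is_haar :: "'g::topological_group_add measure \<Rightarrow> bool" where
  "is_haar M \<longleftrightarrow>
     sets M = sets borel \<and> prob_space M \<and>
     (\<forall>x. distr M M ((+) x) = M) \<and>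
     (\<forall>A\<in>sets M. emeasure M A = (INF U\<in>{U. open U \<and> A \<subseteq> U}. emeasure M U))"

definition haar :: "'g::topological_group_add measure" where
  "haar = (THE M. is_haar M)"


section \<open>The Hilbert space of square-integrable functions\<close>

definition sq_integrable :: "'a measure \<Rightarrow> ('a \<Rightarrow> complex) \<Rightarrow> bool" where
  "sq_integrable M f \<longleftrightarrow> f \<in> borel_measurable M \<and> integrable M (\<lambda>x. (cmod (f x))\<^sup>2)"

lemma sq_integrable_0: "sq_integrable M (\<lambda>_. 0)"
  by (simp add: sq_integrable_def)

lemma sq_integrable_add:
  assumes "sq_integrable M f" "sq_integrable M g"
  shows "sq_integrable M (\<lambda>x. f x + g x)"
proof -
  have m: "f \<in> borel_measurable M" "g \<in> borel_measurable M"
    using assms by (auto simp: sq_integrable_def)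
  have i: "integrable M (\<lambda>x. 2 * (cmod (f x))\<^sup>2 + 2 * (cmod (g x))\<^sup>2)"
    using assms by (auto simp: sq_integrable_def)
  have b: "(cmod (a + b))\<^sup>2 \<le> 2 * (cmod a)\<^sup>2 + 2 * (cmod b)\<^sup>2" for a b :: complex
  proof -
    have "(cmod (a + b))\<^sup>2 \<le> (cmod a + cmod b)\<^sup>2"
      by (intro power_mono norm_triangle_ineq norm_ge_zero)
    also have "\<dots> \<le> 2 * (cmod a)\<^sup>2 + 2 * (cmod b)\<^sup>2"
      using sum_squares_bound[of "cmod a" "cmod b"] by (simp add: power2_sum)
    finally show ?thesis .
  qed
  from i have "integrable M (\<lambda>x. (cmod (f x + g x))\<^sup>2)"
  proof (rule Bochner_Integration.integrable_bound)
    show "(\<lambda>x. (cmod (f x + g x))\<^sup>2) \<in> borel_measurable M"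
      using m by measurable
    show "AE x in M. norm ((cmod (f x + g x))\<^sup>2)
        \<le> norm (2 * (cmod (f x))\<^sup>2 + 2 * (cmod (g x))\<^sup>2)"
      by (rule AE_I2) (simp add: b)
  qed
  with m show ?thesis by (auto simp: sq_integrable_def)
qed

lemma sq_integrable_cmult:
  "sq_integrable M f \<Longrightarrow> sq_integrable M (\<lambda>x. c * f x)"
  by (auto simp: sq_integrable_def norm_mult power_mult_distrib)

lemma measurable_cnj:
  "f \<in> borel_measurable M \<Longrightarrow> (\<lambda>x. cnj (f x)) \<in> borel_measurable M"
  by (rule borel_measurable_continuous_on[of cnj]) (rule continuous_on_cnj[OF continuous_on_id])

lemma integrable_cnj_mult:
  assumes "sq_integrable M f" "sq_integrable M g"
  shows "integrable M (\<lambda>x. cnj (f x) * g x)"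
proof -
  have m: "f \<in> borel_measurable M" "g \<in> borel_measurable M"
    using assms by (auto simp: sq_integrable_def)
  have i: "integrable M (\<lambda>x. (cmod (f x))\<^sup>2 + (cmod (g x))\<^sup>2)"
    using assms by (auto simp: sq_integrable_def)
  have b: "cmod (cnj a * b) \<le> (cmod a)\<^sup>2 + (cmod b)\<^sup>2" for a b :: complex
    using sum_squares_bound[of "cmod a" "cmod b"] mult_nonneg_nonneg[of "cmod a" "cmod b"]
    by (simp add: norm_mult del: mult_nonneg_nonneg)
  from i show ?thesis
  proof (rule Bochner_Integration.integrable_bound)
    show "(\<lambda>x. cnj (f x) * g x) \<in> borel_measurable M"
      using m by (intro borel_measurable_times measurable_cnj)
    show "AE x in M. norm (cnj (f x) * g x) \<le> norm ((cmod (f x))\<^sup>2 + (cmod (g x))\<^sup>2)"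
      by (rule AE_I2) (use b in simp)
  qed
qed

definition l2_rel :: "('g::topological_group_add \<Rightarrow> complex) \<Rightarrow> ('g \<Rightarrow> complex) \<Rightarrow> bool" where
  "l2_rel f g \<longleftrightarrow>
     sq_integrable haar f \<and> sq_integrable haar g \<and> (AE x in haar. f x = g x)"

lemma part_equivp_l2_rel: "part_equivp l2_rel"
proof (rule part_equivpI)
  show "\<exists>f::'a \<Rightarrow> complex. l2_rel f f"
    by (rule exI[of _ "\<lambda>_. 0"]) (simp add: l2_rel_def sq_integrable_0)
  show "symp (l2_rel :: ('a \<Rightarrow> complex) \<Rightarrow> _)"
    by (auto simp: symp_def l2_rel_def elim: eventually_mono)
  show "transp (l2_rel :: ('a \<Rightarrow> complex) \<Rightarrow> _)"
    by (auto simp: transp_def l2_rel_def elim: eventually_elim2)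
qed

quotient_type (overloaded) 'g l2 = "'g::topological_group_add \<Rightarrow> complex" / partial: l2_rel
  by (rule part_equivp_l2_rel)

lift_definition scaleC :: "complex \<Rightarrow> 'g::topological_group_add l2 \<Rightarrow> 'g l2"
  is "\<lambda>c f x. c * f x"
  by (auto simp: l2_rel_def sq_integrable_cmult elim: eventually_mono)

text \<open>The inner product is conjugate-linear in the first argument.\<close>

lift_definition cinner :: "'g::topological_group_add l2 \<Rightarrow> 'g l2 \<Rightarrow> complex"
  is "\<lambda>f g. \<integral>x. cnj (f x) * g x \<partial>haar"
proof -
  fix f f' g g' :: "'g \<Rightarrow> complex"
  assume f: "l2_rel f f'" and g: "l2_rel g g'"
  have "AE x in haar. cnj (f x) * g x = cnj (f' x) * g' x"
    using f g by (auto simp: l2_rel_def elim: eventually_elim2)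
  then show "(\<integral>x. cnj (f x) * g x \<partial>haar) = (\<integral>x. cnj (f' x) * g' x \<partial>haar)"
    using f g by (intro Bochner_Integration.integral_cong_AE borel_measurable_times measurable_cnj)
      (simp_all add: l2_rel_def sq_integrable_def)
qed

text \<open>
  The real inner product below is the real part of \<^const>\<open>cinner\<close>, so that the library norm of
  \<^typ>\<open>'g l2\<close> is the usual one.
\<close>

instantiation l2 :: (topological_group_add) real_inner
begin

lift_definition zero_l2 :: "'a l2" is "\<lambda>_. 0"
  by (simp add: l2_rel_def sq_integrable_0)

lift_definition plus_l2 :: "'a l2 \<Rightarrow> 'a l2 \<Rightarrow> 'a l2" is "\<lambda>f g x. f x + g x"
  by (auto simp: l2_rel_def sq_integrable_add elim: eventually_elim2)

definition uminus_l2 :: "'a l2 \<Rightarrow> 'a l2" where "- u = scaleC (-1) u"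

definition minus_l2 :: "'a l2 \<Rightarrow> 'a l2 \<Rightarrow> 'a l2" where "u - v = u + (- v :: 'a l2)"

definition scaleR_l2 :: "real \<Rightarrow> 'a l2 \<Rightarrow> 'a l2" where "r *\<^sub>R u = scaleC (of_real r) u"

definition inner_l2 :: "'a l2 \<Rightarrow> 'a l2 \<Rightarrow> real" where "inner u v = Re (cinner u v)"

definition norm_l2 :: "'a l2 \<Rightarrow> real" where "norm u = sqrt (inner u (u :: 'a l2))"

definition sgn_l2 :: "'a l2 \<Rightarrow> 'a l2" where "sgn u = inverse (norm u) *\<^sub>R (u :: 'a l2)"

definition dist_l2 :: "'a l2 \<Rightarrow> 'a l2 \<Rightarrow> real" where "dist u v = norm (u - v :: 'a l2)"

definition uniformity_l2 :: "('a l2 \<times> 'a l2) filter" where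
  "uniformity_l2 = (INF e\<in>{0<..}. principal {(u, v). dist u v < e})"

definition open_l2 :: "'a l2 set \<Rightarrow> bool" where
  "open_l2 U \<longleftrightarrow> (\<forall>u\<in>U. \<forall>\<^sub>F (u', v) in uniformity. u' = u \<longrightarrow> v \<in> U)"

instance
proof
  fix u v w :: "'a l2" and a b :: real and U :: "'a l2 set"
  show "u + v + w = u + (v + w)"
    by transfer (auto simp: l2_rel_def ac_simps intro!: sq_integrable_add)
  show "u + v = v + u"
    by transfer (auto simp: l2_rel_def ac_simps intro!: sq_integrable_add)
  show "0 + u = u"
    by transfer (auto simp: l2_rel_def)
  show "- u + u = 0"
    unfolding uminus_l2_def by transfer (auto simp: l2_rel_def sq_integrable_0)
  show "u - v = u + - v"
    by (simp add: minus_l2_def)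
  show "a *\<^sub>R (u + v) = a *\<^sub>R u + a *\<^sub>R v"
    unfolding scaleR_l2_def
    by transfer (auto simp: l2_rel_def distrib_left distrib_right intro!: sq_integrable_add sq_integrable_cmult)
  show "(a + b) *\<^sub>R u = a *\<^sub>R u + b *\<^sub>R u"
    unfolding scaleR_l2_def
    by transfer (auto simp: l2_rel_def distrib_left distrib_right intro!: sq_integrable_add sq_integrable_cmult)
  show "a *\<^sub>R b *\<^sub>R u = (a * b) *\<^sub>R u"
    unfolding scaleR_l2_def
    by transfer (auto simp: l2_rel_def mult.assoc intro!: sq_integrable_cmult)
  show "1 *\<^sub>R u = u"
    unfolding scaleR_l2_def by transfer (auto simp: l2_rel_def)
  show "sgn u = inverse (norm u) *\<^sub>R u"
    by (rule sgn_l2_def)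
  show "dist u v = norm (u - v)"
    by (rule dist_l2_def)
  show "uniformity = (INF e\<in>{0<..}. principal {(u :: 'a l2, v). dist u v < e})"
    by (rule uniformity_l2_def)
  show "open U = (\<forall>u\<in>U. \<forall>\<^sub>F (u', v) in uniformity. u' = u \<longrightarrow> v \<in> U)"
    by (rule open_l2_def)
  show "inner u v = inner v u"
    unfolding inner_l2_def
  proof transfer
    fix f g :: "'a \<Rightarrow> complex"
    have "(\<integral>x. cnj (f x) * g x \<partial>haar) = (\<integral>x. cnj (cnj (g x) * f x) \<partial>haar)"
      by (simp add: mult.commute)
    also have "\<dots> = cnj (\<integral>x. cnj (g x) * f x \<partial>haar)"
      by (rule Bochner_Integration.integral_cnj)
    finally show "Re (\<integral>x. cnj (f x) * g x \<partial>haar) = Re (\<integral>x. cnj (g x) * f x \<partial>haar)"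
      by simp
  qed
  show "inner (u + v) w = inner u w + inner v w"
    unfolding inner_l2_def
    by transfer (simp add: l2_rel_def distrib_right integrable_cnj_mult)
  show "inner (a *\<^sub>R u) v = a * inner u v"
    unfolding inner_l2_def scaleR_l2_def
    by transfer (simp add: mult.assoc)
  have *: "cnj z * z = of_real ((cmod z)\<^sup>2)" for z :: complex
    by (metis complex_norm_square mult.commute)
  have **: "Re (\<integral>x. cnj (f x) * f x \<partial>haar) = (\<integral>x. (cmod (f x))\<^sup>2 \<partial>haar)"
    for f :: "'a \<Rightarrow> complex"
    by (simp only: * integral_complex_of_real Re_complex_of_real)
  show "0 \<le> inner u u"
    unfolding inner_l2_def by transfer (simp add: **)
  show "inner u u = 0 \<longleftrightarrow> u = 0"
    unfolding inner_l2_def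
  proof transfer
    fix f :: "'a \<Rightarrow> complex" assume "l2_rel f f"
    then have f: "sq_integrable haar f" by (simp add: l2_rel_def)
    then have "(\<integral>x. (cmod (f x))\<^sup>2 \<partial>haar) = 0 \<longleftrightarrow> (AE x in haar. (cmod (f x))\<^sup>2 = 0)"
      by (intro integral_nonneg_eq_0_iff_AE) (auto simp: sq_integrable_def)
    with f show "Re (\<integral>x. cnj (f x) * f x \<partial>haar) = 0 \<longleftrightarrow> l2_rel f (\<lambda>_. 0)"
      by (simp add: ** l2_rel_def sq_integrable_0)
  qed
  show "norm u = sqrt (inner u u)"
    by (rule norm_l2_def)
qed

end

text \<open>
  Multiplication by a bounded measurable function and, for the Haar measure of a compact group,
  right translation respect \<^const>\<open>l2_rel\<close>, so the following definitions do not depend on the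
  representative chosen by \<^const>\<open>rep_l2\<close>.
\<close>

definition mult_op :: "('g::topological_group_add \<Rightarrow> complex) \<Rightarrow> 'g l2 \<Rightarrow> 'g l2" where
  "mult_op f u = abs_l2 (\<lambda>y. f y * rep_l2 u y)"

definition right_reg :: "'g::topological_group_add \<Rightarrow> 'g l2 \<Rightarrow> 'g l2" where
  "right_reg x u = abs_l2 (\<lambda>y. rep_l2 u (y + x))"


section \<open>Operators on the Hilbert space\<close>

definition csubspace :: "'g::topological_group_add l2 set \<Rightarrow> bool" where
  "csubspace S \<longleftrightarrow>
     0 \<in> S \<and> (\<forall>u\<in>S. \<forall>v\<in>S. u + v \<in> S) \<and> (\<forall>c. \<forall>u\<in>S. scaleC c u \<in> S)"

definition clinear_on ::
    "'g::topological_group_add l2 set \<Rightarrow> ('g l2 \<Rightarrow> 'g l2) \<Rightarrow> bool" where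
  "clinear_on S T \<longleftrightarrow>
     (\<forall>u\<in>S. \<forall>v\<in>S. T (u + v) = T u + T v) \<and> (\<forall>c. \<forall>u\<in>S. T (scaleC c u) = scaleC c (T u))"

definition bounded_op :: "('g::topological_group_add l2 \<Rightarrow> 'g l2) \<Rightarrow> bool" where
  "bounded_op T \<longleftrightarrow> clinear_on UNIV T \<and> bounded_linear T"

definition compact_op :: "('g::topological_group_add l2 \<Rightarrow> 'g l2) \<Rightarrow> bool" where
  "compact_op T \<longleftrightarrow> bounded_op T \<and> compact (closure (T ` cball 0 1))"

text \<open>
  An unbounded operator is given by its domain \<open>S\<close> together with a function \<open>D\<close>, whose values
  outside \<open>S\<close> are irrelevant. The last conjunct says that the graph of the operator is the graph
  of its adjoint, domains included.
\<close>

definition self_adjoint ::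
    "'g::topological_group_add l2 set \<Rightarrow> ('g l2 \<Rightarrow> 'g l2) \<Rightarrow> bool" where
  "self_adjoint S D \<longleftrightarrow>
     csubspace S \<and> closure S = UNIV \<and> clinear_on S D \<and>
     (\<forall>u w. u \<in> S \<and> w = D u \<longleftrightarrow> (\<forall>v\<in>S. cinner (D v) u = cinner v w))"

definition is_resolvent ::
    "'g::topological_group_add l2 set \<Rightarrow> ('g l2 \<Rightarrow> 'g l2) \<Rightarrow> complex \<Rightarrow> ('g l2 \<Rightarrow> 'g l2) \<Rightarrow> bool"
  where
  "is_resolvent S D z T \<longleftrightarrow>
     bounded_op T \<and>
     (\<forall>u. T u \<in> S \<and> D (T u) - scaleC z (T u) = u) \<and>
     (\<forall>u\<in>S. T (D u - scaleC z u) = u)"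

text \<open>By the resolvent identity, one compact resolvent makes all of them compact.\<close>

definition compact_resolvent ::
    "'g::topological_group_add l2 set \<Rightarrow> ('g l2 \<Rightarrow> 'g l2) \<Rightarrow> bool" where
  "compact_resolvent S D \<longleftrightarrow> (\<exists>z T. is_resolvent S D z T \<and> compact_op T)"

definition orthonormal_basis :: "'g::topological_group_add l2 set \<Rightarrow> bool" where
  "orthonormal_basis B \<longleftrightarrow>
     (\<forall>e\<in>B. \<forall>e'\<in>B. cinner e e' = (if e = e' then 1 else 0)) \<and>
     closure (csubspace hull B) = UNIV"

text \<open>
  For positive bounded operators, the only ones it is used for, the trace does not depend on the
  orthonormal basis.
\<close>

definition finite_trace :: "('g::topological_group_add l2 \<Rightarrow> 'g l2) \<Rightarrow> bool" where
  "finite_trace T \<longleftrightarrow>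
     (\<exists>B. orthonormal_basis B \<and> (\<lambda>e. cinner e (T e)) summable_on B)"

text \<open>
  \<open>T = |D|\<^sup>-\<^sup>s\<close> in the sense of the functional calculus, for \<open>D\<close> self-adjoint with compact
  resolvent. The eigenvectors of such a \<open>D\<close> (whose eigenvalues are real) span a dense subspace,
  so that a bounded operator \<open>T\<close> is determined by its values on them.
\<close>

definition is_abs_powr ::
    "'g::topological_group_add l2 set \<Rightarrow> ('g l2 \<Rightarrow> 'g l2) \<Rightarrow> real \<Rightarrow> ('g l2 \<Rightarrow> 'g l2) \<Rightarrow> bool"
  where
  "is_abs_powr S D s T \<longleftrightarrow>
     bounded_op T \<and>
     (\<forall>(r::real) u. u \<in> S \<and> D u = r *\<^sub>R u \<longrightarrow>
        T u = (if r = 0 then 0 else (\<bar>r\<bar> powr (- s)) *\<^sub>R u))"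

definition s_summable ::
    "'g::topological_group_add l2 set \<Rightarrow> ('g l2 \<Rightarrow> 'g l2) \<Rightarrow> real \<Rightarrow> bool" where
  "s_summable S D s \<longleftrightarrow> (\<exists>T. is_abs_powr S D s T \<and> finite_trace T)"


section \<open>Representative functions\<close>

text \<open>
  A finite-dimensional unitary representation in matrix form. Irreducible unitary representations
  of compact groups are finite-dimensional, and a choice of orthonormal basis turns them into
  matrices.
\<close>

definition unitary_rep :: "nat \<Rightarrow> ('g::topological_group_add \<Rightarrow> complex mat) \<Rightarrow> bool" where
  "unitary_rep n \<rho> \<longleftrightarrow>
     (\<forall>x. \<rho> x \<in> carrier_mat n n \<and> mat_adjoint (\<rho> x) * \<rho> x = 1\<^sub>m n) \<and>
     (\<forall>x y. \<rho> (x + y) = \<rho> x * \<rho> y) \<and>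
     (\<forall>i<n. \<forall>j<n. continuous_on UNIV (\<lambda>x. \<rho> x $$ (i, j)))"

definition irreducible_rep :: "nat \<Rightarrow> ('g::topological_group_add \<Rightarrow> complex mat) \<Rightarrow> bool" where
  "irreducible_rep n \<rho> \<longleftrightarrow>
     0 < n \<and>
     (\<forall>W \<subseteq> carrier_vec n.
        0\<^sub>v n \<in> W \<and> (\<forall>v\<in>W. \<forall>w\<in>W. v + w \<in> W) \<and> (\<forall>c. \<forall>v\<in>W. c \<cdot>\<^sub>v v \<in> W) \<and>
        (\<forall>x. \<forall>v\<in>W. \<rho> x *\<^sub>v v \<in> W)
        \<longrightarrow> W = {0\<^sub>v n} \<or> W = carrier_vec n)"

inductive_set representative_functions :: "('g::topological_group_add \<Rightarrow> complex) set" where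
  entry: "(\<lambda>x. \<rho> x $$ (i, j)) \<in> representative_functions"
    if "unitary_rep n \<rho>" "irreducible_rep n \<rho>" "i < n" "j < n"
| add: "(\<lambda>x. f x + g x) \<in> representative_functions"
    if "f \<in> representative_functions" "g \<in> representative_functions"
| scale: "(\<lambda>x. c * f x) \<in> representative_functions"
    if "f \<in> representative_functions"
| mult: "(\<lambda>x. f x * g x) \<in> representative_functions"
    if "f \<in> representative_functions" "g \<in> representative_functions"
| star: "(\<lambda>x. cnj (f x)) \<in> representative_functions"
    if "f \<in> representative_functions"

text \<open>
  The algebra \<open>\<A>\<close> of those \<open>f \<in> C(G)\<close> for which \<open>\<Delta>(f) : (x, y) \<mapsto> f (x + y)\<close> is a finite sum
  \<open>\<Sum>k. a k \<otimes> b k\<close> with \<open>a k \<in> C(G)\<close> and \<open>b k \<in> \<O>(G)\<close>.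
\<close>

definition smooth_algebra :: "('g::topological_group_add \<Rightarrow> complex) set" where
  "smooth_algebra =
     {f. continuous_on UNIV f \<and>
         (\<exists>(n::nat) a b.
            (\<forall>k<n. continuous_on UNIV (a k) \<and> b k \<in> representative_functions) \<and>
            (\<forall>x y. f (x + y) = (\<Sum>k<n. a k x * b k y)))}"


section \<open>Spectral dimension\<close>

definition spectral_triple ::
    "('g::topological_group_add \<Rightarrow> complex) set \<Rightarrow> 'g l2 set \<Rightarrow> ('g l2 \<Rightarrow> 'g l2) \<Rightarrow> bool" where
  "spectral_triple A S D \<longleftrightarrow>
     self_adjoint S D \<and> compact_resolvent S D \<and>
     (\<forall>f\<in>A. mult_op f ` S \<subseteq> S \<and>
        (\<exists>T. bounded_op T \<and> (\<forall>u\<in>S. T u = D (mult_op f u) - mult_op f (D u))))"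

text \<open>
  The inclusion for both \<open>x\<close> and \<open>- x\<close> makes every right translation map the domain onto itself.
\<close>

definition equivariant :: "'g::topological_group_add l2 set \<Rightarrow> ('g l2 \<Rightarrow> 'g l2) \<Rightarrow> bool" where
  "equivariant S D \<longleftrightarrow>
     (\<forall>x. right_reg x ` S \<subseteq> S \<and> (\<forall>u\<in>S. D (right_reg x u) = right_reg x (D u)))"

text \<open>An extended real, with value \<open>\<infinity>\<close> if no \<open>s\<close> is admissible.\<close>

definition spectral_dim :: "'g::topological_group_add itself \<Rightarrow> ereal" where
  "spectral_dim (t :: 'g itself) =
     Inf {ereal s | s. s > 0 \<and>
       (\<exists>(S :: 'g l2 set) D.
          spectral_triple smooth_algebra S D \<and> equivariant S D \<and> s_summable S D s)}"

end

theory Submission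
  imports Defs
begin

text \<open>
  The group has a decreasing sequence of open normal subgroups \<open>N k\<close> that form a neighbourhood base
  of the identity. The \<open>N k\<close>-invariant functions form an increasing sequence of finite-dimensional
  subspaces of \<open>L\<^sup>2(G)\<close> with dense union, each of them invariant under right translations. Let \<open>D\<close> act as
  a scalar on each successive orthogonal complement; it commutes with right translations, and
  if the scalars grow fast enough compared with the dimensions, \<open>D\<close> is \<open>s\<close>-summable for every \<open>s > 0\<close>.
  A unitary group has no small subgroups, so each matrix entry of a representation, and hence
  each \<open>f \<in> \<A>\<close>, is \<open>N k\<close>-invariant for some \<open>k\<close>. Multiplication by \<open>f\<close> then preserves all but
  finitely many of the complements, and the commutator with \<open>D\<close> has finite rank.

  The operator \<open>D\<close> is obtained as the inverse of an injective compact symmetric operator \<open>T\<close> with dense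
  range, which makes self-adjointness immediate and gives \<open>T\<close> as resolvent at \<open>0\<close>.
\<close>

section \<open>The Hilbert space\<close>

text \<open>\<open>haar\<close> is a definite description, so its invariance has to wait for
  existence and uniqueness. Here both reduce to counting: translation invariance forces each of the
  finitely many cosets of \<open>N k\<close> to have measure one over their number, and these values
  fit together because every coset of one level splits into equally many of any finer level.

  Three features of the diagonal construction answer to difficulties. The coset indicators of all
  levels together are linearly dependent, and L^2(G) is finite-dimensional when G is finite, so the
  orthonormal sequence may contain zero vectors. The scalar of a vector depends only on its level,
  since right translations mix the vectors of one level. The eigenvalue of \<open>T\<close> at level
  k is 1/2 to the number of indicators listed up to level k, so it is at most (1/2)^i at each index
  i of that level, whatever the dimensions are.

  Relations between \<open>D\<close> and a bounded operator are proved after multiplying by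
  \<open>T\<close>, as identities of bounded operators tested on matrix entries; that the operator
  preserves the domain comes out of the same identity.\<close>

lemma sq_integrable_rep_l2: "sq_integrable haar (rep_l2 u)"
  using Quotient_rep_reflp[OF Quotient_l2, of u] by (auto simp: l2_rel_def)

lemma abs_rep_l2 [simp]: "abs_l2 (rep_l2 u) = u"
  using Quotient_abs_rep[OF Quotient_l2] .

lemma abs_l2_eqI:
  assumes "sq_integrable haar f" "sq_integrable haar g" "AE x in haar. f x = g x"
  shows "abs_l2 f = abs_l2 g"
  using Quotient_rel_abs[OF Quotient_l2, of f g] assms by (auto simp: l2_rel_def)

lemma rep_abs_l2_AE:
  assumes "sq_integrable haar f"
  shows "AE x in haar. rep_l2 (abs_l2 f) x = f x"
proof -
  have "l2_rel f f" using assms by (simp add: l2_rel_def)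
  then show ?thesis
    using Quotient_rep_abs[OF Quotient_l2, of f] by (auto simp: l2_rel_def)
qed

lemma abs_l2_add:
  assumes "sq_integrable haar f" "sq_integrable haar g"
  shows "abs_l2 f + abs_l2 g = abs_l2 (\<lambda>x. f x + g x)"
  using assms by (intro plus_l2.abs_eq) (auto simp: eq_onp_def l2_rel_def)

lemma abs_l2_scaleC:
  assumes "sq_integrable haar f"
  shows "scaleC c (abs_l2 f) = abs_l2 (\<lambda>x. c * f x)"
  using assms by (intro scaleC.abs_eq) (auto simp: eq_onp_def l2_rel_def)

lemma cinner_abs_l2:
  assumes "sq_integrable haar f" "sq_integrable haar g"
  shows "cinner (abs_l2 f) (abs_l2 g) = (\<integral>x. cnj (f x) * g x \<partial>haar)"
  using assms by (intro cinner.abs_eq) (auto simp: eq_onp_def l2_rel_def)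

lemma cinner_add_left: "cinner (u + v) w = cinner u w + cinner v w"
  by transfer (simp add: l2_rel_def distrib_right integrable_cnj_mult)

lemma cinner_add_right: "cinner w (u + v) = cinner w u + cinner w v"
  by transfer (simp add: l2_rel_def distrib_left integrable_cnj_mult)

lemma cinner_scaleC_right: "cinner u (scaleC c v) = c * cinner u v"
  by transfer (simp add: mult.left_commute)

lemma cinner_commute: "cinner u v = cnj (cinner v u)"
proof transfer
  fix f g :: "'a \<Rightarrow> complex"
  have "(\<integral>x. cnj (f x) * g x \<partial>haar) = (\<integral>x. cnj (cnj (g x) * f x) \<partial>haar)"
    by (simp add: mult.commute)
  also have "\<dots> = cnj (\<integral>x. cnj (g x) * f x \<partial>haar)"
    by (rule Bochner_Integration.integral_cnj)
  finally show "(\<integral>x. cnj (f x) * g x \<partial>haar) = cnj (\<integral>x. cnj (g x) * f x \<partial>haar)" .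
qed

lemma cinner_scaleC_left: "cinner (scaleC c u) v = cnj c * cinner u v"
  by (subst (1 2) cinner_commute) (simp add: cinner_scaleC_right)

lemma scaleC_add_right: "scaleC c (u + v) = scaleC c u + scaleC c v"
  by transfer (auto simp: l2_rel_def distrib_left intro!: sq_integrable_add sq_integrable_cmult)

lemma scaleC_add_left: "scaleC (c + d) u = scaleC c u + scaleC d u"
  by transfer (auto simp: l2_rel_def distrib_right intro!: sq_integrable_add sq_integrable_cmult)

lemma scaleC_scaleC [simp]: "scaleC c (scaleC d u) = scaleC (c * d) u"
  by transfer (auto simp: l2_rel_def mult.assoc intro!: sq_integrable_cmult)

lemma scaleC_of_real: "scaleC (of_real r) u = r *\<^sub>R u"
  by (simp add: scaleR_l2_def)

lemma scaleC_one [simp]: "scaleC 1 u = u"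
  using scaleC_of_real[of 1 u] by simp

lemma scaleC_zero_left [simp]: "scaleC 0 u = 0"
  using scaleC_of_real[of 0 u] by simp

lemma scaleC_zero_right [simp]: "scaleC c 0 = 0"
  by (metis scaleC_zero_left scaleC_scaleC mult_zero_right)

lemma cinner_zero_left [simp]: "cinner 0 u = 0"
  by (metis cinner_scaleC_left scaleC_zero_left complex_cnj_zero mult_zero_left)

lemma cinner_zero_right [simp]: "cinner u 0 = 0"
  by (metis cinner_scaleC_right scaleC_zero_left mult_zero_left)

lemma cinner_self: "cinner u u = of_real ((norm u)\<^sup>2)"
proof -
  have "cinner u u = of_real (Re (cinner u u))"
    using cinner_commute[of u u] by (simp add: complex_eq_iff)
  then show ?thesis by (simp add: power2_norm_eq_inner inner_l2_def)
qed

lemma norm_scaleC: "norm (scaleC c u) = cmod c * norm (u :: 'g::topological_group_add l2)"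
proof -
  have "complex_of_real ((norm (scaleC c u))\<^sup>2) = of_real ((cmod c * norm u)\<^sup>2)"
    unfolding cinner_self[symmetric] cinner_scaleC_left cinner_scaleC_right
    by (simp add: cinner_self complex_norm_square power_mult_distrib del: of_real_power)
  then show ?thesis
    unfolding of_real_eq_iff by (simp add: power2_eq_iff_nonneg)
qed

text \<open>Rotating \<open>v\<close> by a phase makes the inner product real and nonnegative, which
  reduces the claim to the real Cauchy--Schwarz inequality.\<close>

lemma norm_cinner_le: "cmod (cinner u v) \<le> norm u * norm (v :: 'g::topological_group_add l2)"
proof -
  obtain c where c: "cmod c = 1" "c * cinner u v = of_real (cmod (cinner u v))"
  proof (cases "cinner u v = 0")
    case True then show ?thesis using that[of 1] by simp
  next
    case False
    have "cnj (sgn (cinner u v)) * cinner u v = of_real (cmod (cinner u v))"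
    proof -
      have "cnj (sgn (cinner u v)) * cinner u v
          = (cinner u v * cnj (cinner u v)) / of_real (cmod (cinner u v))"
        by (simp add: sgn_div_norm scaleR_conv_of_real field_simps)
      then show ?thesis using False by (simp add: complex_norm_square[symmetric] power2_eq_square)
    qed
    then show ?thesis using that[of "cnj (sgn (cinner u v))"] False by (simp add: norm_sgn)
  qed
  have "cmod (cinner u v) = inner u (scaleC c v)"
    using c(2) by (simp add: inner_l2_def cinner_scaleC_right)
  also have "\<dots> \<le> norm u * norm (scaleC c v)"
    by (rule norm_cauchy_schwarz)
  finally show ?thesis by (simp add: norm_scaleC c)
qed

text \<open>Bilinearity over the reals is enough to exchange the inner product with limits and
  series.\<close>

lemma bounded_bilinear_cinner: "bounded_bilinear (cinner :: 'g::topological_group_add l2 \<Rightarrow> _)"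
proof
  show "\<exists>K. \<forall>u v. norm (cinner u (v :: 'g l2)) \<le> norm u * norm v * K"
    by (intro exI[of _ 1]) (simp add: norm_cinner_le)
qed (simp_all add: cinner_add_left cinner_add_right scaleC_of_real[symmetric] scaleR_conv_of_real
      cinner_scaleC_left cinner_scaleC_right del: scaleC_of_real)

lemma bounded_bilinear_scaleC: "bounded_bilinear (scaleC :: _ \<Rightarrow> 'g::topological_group_add l2 \<Rightarrow> _)"
proof
  show "\<exists>K. \<forall>c u. norm (scaleC c (u :: 'g l2)) \<le> norm c * norm u * K"
    by (intro exI[of _ 1]) (simp add: norm_scaleC)
qed (simp_all add: scaleC_add_left scaleC_add_right scaleC_of_real[symmetric] scaleR_conv_of_real mult.commute
       del: scaleC_of_real)

lemma norm_abs_l2: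
  assumes "sq_integrable haar f"
  shows "(norm (abs_l2 f))\<^sup>2 = (\<integral>x. (cmod (f x))\<^sup>2 \<partial>haar)"
proof -
  have "complex_of_real ((norm (abs_l2 f))\<^sup>2) = (\<integral>x. complex_of_real ((cmod (f x))\<^sup>2) \<partial>haar)"
    unfolding cinner_self[symmetric] cinner_abs_l2[OF assms assms] complex_norm_square
    by (simp add: mult.commute)
  also have "\<dots> = of_real (\<integral>x. (cmod (f x))\<^sup>2 \<partial>haar)"
    by (rule integral_complex_of_real)
  finally show ?thesis unfolding of_real_eq_iff .
qed

section \<open>Completeness of L^2\<close>

lemma uminus_abs_l2: "sq_integrable haar f \<Longrightarrow> - abs_l2 f = abs_l2 (\<lambda>x. - f x)"
  by (simp add: uminus_l2_def abs_l2_scaleC)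

lemma sq_integrable_minus:
  "sq_integrable M f \<Longrightarrow> sq_integrable M g \<Longrightarrow> sq_integrable M (\<lambda>x. f x - g x)"
  using sq_integrable_add[of M f "\<lambda>x. (-1) * g x"] sq_integrable_cmult[of M g "-1"] by simp

lemma abs_l2_diff:
  assumes "sq_integrable haar f" "sq_integrable haar g"
  shows "abs_l2 f - abs_l2 g = abs_l2 (\<lambda>x. f x - g x)"
  using assms sq_integrable_cmult[of haar g "-1"]
  by (simp add: minus_l2_def uminus_abs_l2 abs_l2_add)

text \<open>Weighting the squared increments by \<open>2 ^ k\<close> makes the increments absolutely summable
  almost everywhere by the Cauchy--Schwarz inequality.\<close>

lemma summable_AE_of_fast_sq_summable:
  fixes d :: "nat \<Rightarrow> 'a \<Rightarrow> complex"
  assumes d: "\<And>k. sq_integrable M (d k)"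
    and le: "\<And>k. (\<integral>x. (cmod (d k x))\<^sup>2 \<partial>M) \<le> (1/4) ^ k"
  shows "AE x in M. summable (\<lambda>k. d k x)"
proof -
  have [measurable]: "d k \<in> borel_measurable M" for k using d by (simp add: sq_integrable_def)
  have int: "integrable M (\<lambda>x. (cmod (d k x))\<^sup>2)" for k using d by (simp add: sq_integrable_def)
  have eq: "(\<integral>\<^sup>+x. ennreal (2 ^ k * (cmod (d k x))\<^sup>2) \<partial>M) \<le> ennreal ((1/2) ^ k)" for k
  proof -
    have "(\<integral>\<^sup>+x. ennreal (2 ^ k * (cmod (d k x))\<^sup>2) \<partial>M) = ennreal (2 ^ k * (\<integral>x. (cmod (d k x))\<^sup>2 \<partial>M))"
      using int[of k] by (subst nn_integral_eq_integral) auto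
    also have "\<dots> \<le> ennreal (2 ^ k * (1/4) ^ k)"
      by (intro ennreal_leI mult_left_mono le) auto
    finally show ?thesis by (simp add: power_mult_distrib[symmetric])
  qed
  have "(\<integral>\<^sup>+x. (\<Sum>k. ennreal (2 ^ k * (cmod (d k x))\<^sup>2)) \<partial>M)
      = (\<Sum>k. \<integral>\<^sup>+x. ennreal (2 ^ k * (cmod (d k x))\<^sup>2) \<partial>M)"
    by (rule nn_integral_suminf) measurable
  also have "\<dots> \<le> (\<Sum>k. ennreal ((1/2) ^ k))"
    by (intro suminf_le eq) auto
  also have "\<dots> = ennreal (\<Sum>k. (1/2) ^ k)"
    by (rule suminf_ennreal2) (auto simp: summable_geometric)
  finally have "(\<integral>\<^sup>+x. (\<Sum>k. ennreal (2 ^ k * (cmod (d k x))\<^sup>2)) \<partial>M) \<noteq> \<infinity>"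
    by (auto simp: top_unique)
  then have "AE x in M. (\<Sum>k. ennreal (2 ^ k * (cmod (d k x))\<^sup>2)) \<noteq> \<infinity>"
    by (intro nn_integral_PInf_AE) auto
  then show ?thesis
  proof (rule eventually_mono)
    fix x assume "(\<Sum>k. ennreal (2 ^ k * (cmod (d k x))\<^sup>2)) \<noteq> \<infinity>"
    then have s: "summable (\<lambda>k. 2 ^ k * (cmod (d k x))\<^sup>2)"
      by (intro summable_suminf_not_top) auto
    have "summable (\<lambda>k. (1/2) ^ k + 2 ^ k * (cmod (d k x))\<^sup>2)"
      by (intro summable_add s summable_geometric) auto
    then have "summable (\<lambda>k. cmod (d k x))"
    proof (rule summable_comparison_test'[where N = 0])
      fix k
      \<comment> \<open>The weight is split so that \<open>a * b\<close> is the plain increment; the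
        termwise bound \<open>a * b \<le> a^2 + b^2\<close> then replaces an inequality between
        sums.\<close>
      define a where "a = sqrt ((1/2) ^ k)"
      define b where "b = sqrt (2 ^ k) * cmod (d k x)"
      have "a * b = cmod (d k x)"
        by (simp add: a_def b_def real_sqrt_mult[symmetric] mult.assoc[symmetric] power_mult_distrib[symmetric])
      moreover have "0 \<le> a * b" by (simp add: a_def b_def)
      then have "a * b \<le> a\<^sup>2 + b\<^sup>2"
        using sum_squares_bound[of a b] by linarith
      ultimately show "norm (cmod (d k x)) \<le> (1/2) ^ k + 2 ^ k * (cmod (d k x))\<^sup>2"
        by (simp only: real_norm_def abs_norm_cancel) (simp add: a_def b_def power_mult_distrib)
    qed
    then show "summable (\<lambda>k. d k x)"
      by (rule summable_norm_cancel)
  qed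
qed

text \<open>Fatou's lemma for the squared distances to \<open>f n\<close> yields
  square-integrability of the difference and the bound together, without a dominating
  function.\<close>

lemma sq_integrable_diff_Fatou:
  fixes f :: "nat \<Rightarrow> 'a \<Rightarrow> complex"
  assumes f: "\<And>k. sq_integrable M (f k)"
    and g: "g \<in> borel_measurable M" and lim: "AE x in M. (\<lambda>k. f k x) \<longlonglongrightarrow> g x"
    and B: "\<And>k. k \<ge> n \<Longrightarrow> (\<integral>x. (cmod (f k x - f n x))\<^sup>2 \<partial>M) \<le> B"
  shows "sq_integrable M (\<lambda>x. g x - f n x) \<and> (\<integral>x. (cmod (g x - f n x))\<^sup>2 \<partial>M) \<le> B"
proof -
  have [measurable]: "f k \<in> borel_measurable M" for k using f by (simp add: sq_integrable_def)
  note [measurable] = g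
  have B0: "B \<ge> 0" using B[of n] by simp
  have int: "integrable M (\<lambda>x. (cmod (f k x - f n x))\<^sup>2)" for k
    using sq_integrable_minus[OF f f, of k n] by (simp add: sq_integrable_def)
  have "(\<integral>\<^sup>+x. ennreal ((cmod (g x - f n x))\<^sup>2) \<partial>M)
      = (\<integral>\<^sup>+x. liminf (\<lambda>k. ennreal ((cmod (f k x - f n x))\<^sup>2)) \<partial>M)"
  proof (rule nn_integral_cong_AE, use lim in eventually_elim)
    fix x assume "(\<lambda>k. f k x) \<longlonglongrightarrow> g x"
    then have "(\<lambda>k. ennreal ((cmod (f k x - f n x))\<^sup>2)) \<longlonglongrightarrow> ennreal ((cmod (g x - f n x))\<^sup>2)"
      by (intro tendsto_intros tendsto_ennrealI)
    then show "ennreal ((cmod (g x - f n x))\<^sup>2) = liminf (\<lambda>k. ennreal ((cmod (f k x - f n x))\<^sup>2))"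
      by (intro lim_imp_Liminf[symmetric]) auto
  qed
  also have "\<dots> \<le> liminf (\<lambda>k. \<integral>\<^sup>+x. ennreal ((cmod (f k x - f n x))\<^sup>2) \<partial>M)"
    by (intro nn_integral_liminf) measurable
  also have "\<dots> \<le> ennreal B"
  proof (rule Liminf_le)
    show "\<forall>\<^sub>F k in sequentially. (\<integral>\<^sup>+x. ennreal ((cmod (f k x - f n x))\<^sup>2) \<partial>M) \<le> ennreal B"
      using eventually_ge_at_top[of n]
    proof eventually_elim
      fix k assume "n \<le> k"
      then show "(\<integral>\<^sup>+x. ennreal ((cmod (f k x - f n x))\<^sup>2) \<partial>M) \<le> ennreal B"
        using int[of k] B[of k] B0 by (subst nn_integral_eq_integral) (auto simp: ennreal_leI)
    qed
  qed simp
  finally have le: "(\<integral>\<^sup>+x. ennreal ((cmod (g x - f n x))\<^sup>2) \<partial>M) \<le> ennreal B" .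
  then have i: "integrable M (\<lambda>x. (cmod (g x - f n x))\<^sup>2)"
    by (intro integrableI_bounded) (auto simp: less_top[symmetric] top_unique)
  with le have "(\<integral>x. (cmod (g x - f n x))\<^sup>2 \<partial>M) \<le> B"
    using B0 by (subst (asm) nn_integral_eq_integral) auto
  with i show ?thesis by (auto simp: sq_integrable_def)
qed

text \<open>Riesz--Fischer: a subsequence with geometrically small increments converges almost
  everywhere, and Fatou's lemma turns this into convergence in norm.\<close>

instance l2 :: (topological_group_add) banach
proof
  fix X :: "nat \<Rightarrow> 'a l2"
  assume X: "Cauchy X"
  have "\<exists>N. \<forall>m\<ge>N. \<forall>n\<ge>N. dist (X m) (X n) < (1/2) ^ k" for k
    using X unfolding Cauchy_def by auto
  then obtain N where N: "\<And>k m n. m \<ge> N k \<Longrightarrow> n \<ge> N k \<Longrightarrow> dist (X m) (X n) < (1/2) ^ k"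
    by metis
  \<comment> \<open>The partial sum dominates \<open>N k\<close> and is nondecreasing; the added
    \<open>k\<close> makes \<open>M\<close> strictly increasing, as a subsequence requires.\<close>
  define M where "M k = (\<Sum>j\<le>k. N j) + k" for k
  have M: "M k \<ge> N k" "M k \<ge> k" for k
    using member_le_sum[of k "{..k}" N] by (auto simp: M_def)
  have Mmono: "M j \<le> M k" if "j \<le> k" for j k
    unfolding M_def using that by (intro add_mono sum_mono2) auto
  define f where "f k = rep_l2 (X (M k))" for k
  have fsq: "sq_integrable haar (f k)" for k by (simp add: f_def sq_integrable_rep_l2)
  have fabs: "abs_l2 (f k) = X (M k)" for k by (simp add: f_def)
  have ndiff: "(\<integral>x. (cmod (f k x - f n x))\<^sup>2 \<partial>haar) \<le> (1/4) ^ n" if "k \<ge> n" for k n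
  proof -
    have "(\<integral>x. (cmod (f k x - f n x))\<^sup>2 \<partial>haar) = (dist (X (M k)) (X (M n)))\<^sup>2"
      unfolding dist_norm fabs[symmetric] abs_l2_diff[OF fsq fsq]
      by (rule norm_abs_l2[symmetric]) (intro sq_integrable_minus fsq)
    also have "\<dots> \<le> ((1/2) ^ n)\<^sup>2"
      using N[of n "M k" "M n"] M(1)[of n] Mmono[OF that] by (intro power_mono) auto
    finally show ?thesis by (simp add: power_even_eq[symmetric] power_mult[symmetric] power_mult power_commutes power2_eq_square power_mult_distrib[symmetric])
  qed
  have "AE x in haar. summable (\<lambda>k. f (Suc k) x - f k x)"
    by (intro summable_AE_of_fast_sq_summable sq_integrable_minus fsq ndiff) auto
  then have conv: "AE x in haar. (\<lambda>k. f k x) \<longlonglongrightarrow> lim (\<lambda>k. f k x)"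
  proof (rule eventually_mono)
    fix x assume "summable (\<lambda>k. f (Suc k) x - f k x)"
    then show "(\<lambda>k. f k x) \<longlonglongrightarrow> lim (\<lambda>k. f k x)"
      using sum_lessThan_telescope[of "\<lambda>k. f k x"]
      by (simp add: summable_iff_convergent convergent_diff_const_right_iff convergent_LIMSEQ_iff)
  qed
  have [measurable]: "f k \<in> borel_measurable haar" for k using fsq by (simp add: sq_integrable_def)
  \<comment> \<open>On the null set where the sequence diverges the value of \<open>lim\<close> is
    arbitrary; only measurability matters there.\<close>
  define g where "g x = lim (\<lambda>k. f k x)" for x
  have gm: "g \<in> borel_measurable haar" unfolding g_def by measurable
  have gd: "sq_integrable haar (\<lambda>x. g x - f n x) \<and> (\<integral>x. (cmod (g x - f n x))\<^sup>2 \<partial>haar) \<le> (1/4) ^ n" for n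
    using conv by (intro sq_integrable_diff_Fatou fsq gm ndiff) (auto simp: g_def)
  have gsq: "sq_integrable haar g"
    using sq_integrable_add[OF gd[THEN conjunct1] fsq, of 0 0] by simp
  have lim: "(\<lambda>n. X (M n)) \<longlonglongrightarrow> abs_l2 g"
  proof (rule LIM_zero_cancel, rule tendsto_norm_zero_cancel, rule Lim_null_comparison)
    show "\<forall>\<^sub>F n in sequentially. norm (norm (X (M n) - abs_l2 g)) \<le> (1/2) ^ n"
    proof (rule always_eventually, rule allI)
      fix n
      have "(norm (X (M n) - abs_l2 g))\<^sup>2 = (norm (abs_l2 (\<lambda>x. g x - f n x)))\<^sup>2"
        unfolding fabs[symmetric] by (subst norm_minus_commute) (simp add: abs_l2_diff gsq fsq)
      also have "\<dots> \<le> (1/4) ^ n"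
        using gd by (simp add: norm_abs_l2)
      also have "\<dots> = ((1/2) ^ n)\<^sup>2"
        by (simp add: power2_eq_square power_mult_distrib[symmetric])
      finally show "norm (norm (X (M n) - abs_l2 g)) \<le> (1/2) ^ n"
        by (simp add: abs_le_square_iff[symmetric])
    qed
  qed (auto intro: LIMSEQ_power_zero)
  show "convergent X"
  proof -
    have "strict_mono M" by (simp add: strict_mono_Suc_iff M_def)
    then have "X \<longlonglongrightarrow> abs_l2 g"
      using Cauchy_converges_subseq[OF X] lim by (simp add: comp_def)
    then show ?thesis by (auto simp: convergent_def)
  qed
qed


section \<open>Diagonal operators\<close>

lemma csubspace_hull: "csubspace (csubspace hull B)"
  unfolding csubspace_def by (auto simp: hull_def csubspace_def)

lemma csubspace_sum:
  "csubspace S \<Longrightarrow> (\<And>i. i \<in> I \<Longrightarrow> f i \<in> S) \<Longrightarrow> sum f I \<in> S"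
  by (induction I rule: infinite_finite_induct) (auto simp: csubspace_def)

lemma csubspace_minus:
  assumes "csubspace S" "u \<in> S" "v \<in> S" shows "u - v \<in> S"
  using assms unfolding csubspace_def minus_l2_def uminus_l2_def by blast

lemma csubspace_scaleR: "csubspace S \<Longrightarrow> u \<in> S \<Longrightarrow> r *\<^sub>R u \<in> S"
  unfolding csubspace_def scaleR_l2_def by blast

lemma clinear_on_0: "clinear_on UNIV A \<Longrightarrow> A 0 = 0"
  unfolding clinear_on_def by (metis UNIV_I scaleC_zero_left)

lemma bounded_op_add: "bounded_op A \<Longrightarrow> A (u + v) = A u + A v"
  and bounded_op_scaleC: "bounded_op A \<Longrightarrow> A (scaleC c u) = scaleC c (A u)"
  and bounded_op_0: "bounded_op A \<Longrightarrow> A 0 = 0"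
  by (auto simp: bounded_op_def clinear_on_def clinear_on_0)

lemma bounded_opI:
  assumes "\<And>u v. A (u + v) = A u + A v" "\<And>c u. A (scaleC c u) = scaleC c (A u)"
    and "\<And>u. norm (A u) \<le> norm u * K"
  shows "bounded_op A"
  unfolding bounded_op_def clinear_on_def
  using assms by (auto intro!: bounded_linear_intro[of A K] simp: scaleR_l2_def)

lemma bounded_op_compose: "bounded_op A \<Longrightarrow> bounded_op B \<Longrightarrow> bounded_op (\<lambda>u. A (B u))"
  by (auto simp: bounded_op_def clinear_on_def intro: bounded_linear_compose)

lemma bounded_op_plus: "bounded_op A \<Longrightarrow> bounded_op B \<Longrightarrow> bounded_op (\<lambda>u. A u + B u)"
  by (auto simp: bounded_op_def clinear_on_def scaleC_add_right algebra_simps intro: bounded_linear_add)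

lemma bounded_op_zero: "bounded_op (\<lambda>u. 0)"
  by (auto simp: bounded_op_def clinear_on_def)

lemma bounded_op_sum: "(\<And>i. i \<in> I \<Longrightarrow> bounded_op (A i)) \<Longrightarrow> bounded_op (\<lambda>u. \<Sum>i\<in>I. A i u)"
  by (induction I rule: infinite_finite_induct) (auto simp: bounded_op_zero bounded_op_plus)

lemma bounded_op_rank_one: "bounded_op (\<lambda>u. scaleC (c * cinner x u) y)"
proof (rule bounded_opI)
  fix u
  have "cmod c * cmod (cinner x u) * norm y \<le> cmod c * (norm x * norm u) * norm y"
    by (intro mult_right_mono mult_left_mono norm_cinner_le) auto
  then show "norm (scaleC (c * cinner x u) y) \<le> norm u * (cmod c * norm x * norm y)"
    by (simp add: norm_scaleC norm_mult mult_ac)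
qed (auto simp: cinner_add_right cinner_scaleC_right scaleC_add_left ring_distribs mult_ac)

lemma cinner_sum_right: "cinner u (sum f I) = (\<Sum>i\<in>I. cinner u (f i))"
  by (induction I rule: infinite_finite_induct) (auto simp: cinner_add_right)

text \<open>The equalizer of two bounded operators is a closed complex subspace.\<close>

lemma bounded_op_eqI_on_total:
  assumes B: "closure (csubspace hull B) = UNIV"
    and S: "bounded_op S" and T: "bounded_op T" and eq: "\<And>u. u \<in> B \<Longrightarrow> S u = T u"
  shows "S = T"
proof -
  have "csubspace {u. S u = T u}"
    using S T by (auto simp: csubspace_def bounded_op_def clinear_on_def clinear_on_0)
  then have "csubspace hull B \<subseteq> {u. S u = T u}"
    using eq by (intro hull_minimal) auto
  moreover have "closed {u. S u = T u}"
    using S T by (intro closed_Collect_eq linear_continuous_on) (auto simp: bounded_op_def)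
  ultimately have "UNIV \<subseteq> {u. S u = T u}"
    unfolding B[symmetric] by (rule closure_minimal)
  then show ?thesis by auto
qed

lemma orthogonal_to_total_eq_0:
  assumes B: "closure (csubspace hull B) = UNIV" and "\<And>v. v \<in> B \<Longrightarrow> cinner v u = 0"
  shows "u = 0"
proof -
  \<comment> \<open>This rank-one operator kills \<open>B\<close>, hence everything, in particular
    \<open>u\<close> itself. The factor 1 fits the shape of
    \<open>bounded_op_rank_one\<close>.\<close>
  have "(\<lambda>v. scaleC (1 * cinner u v) u) = (\<lambda>v. 0)"
    using assms(2) cinner_commute[of u]
    by (intro bounded_op_eqI_on_total[OF B bounded_op_rank_one bounded_op_zero]) simp
  then have "scaleC (cinner u u) u = 0" by (metis mult_1)
  then show ?thesis by (metis cinner_scaleC_right cinner_zero_right cinner_self mult_eq_0_iff norm_eq_zero of_real_eq_0_iff zero_eq_power2)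
qed

locale total_orthonormal_sequence =
  fixes e :: "nat \<Rightarrow> 'g::topological_group_add l2"
  assumes orth: "i \<noteq> j \<Longrightarrow> cinner (e i) (e j) = 0"
    and unit: "e i = 0 \<or> cinner (e i) (e i) = 1"
    and total: "closure (csubspace hull (range e)) = UNIV"
begin

lemma norm_e_le: "norm (e i) \<le> 1"
  using unit[of i] by (auto simp: cinner_self simp flip: of_real_power)
     (smt (verit, best) norm_ge_zero one_power2 power2_eq_iff_nonneg)

lemma eqI: "(\<And>i. cinner (e i) u = cinner (e i) v) \<Longrightarrow> u = v"
  using orthogonal_to_total_eq_0[OF total, of "u - v"]
  by (auto simp: bounded_bilinear.diff_right[OF bounded_bilinear_cinner])

lemma op_eqI:
  "bounded_op A \<Longrightarrow> bounded_op B \<Longrightarrow> (\<And>i j. cinner (e i) (A (e j)) = cinner (e i) (B (e j))) \<Longrightarrow> A = B"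
  by (rule bounded_op_eqI_on_total[OF total]) (auto intro: eqI)

text \<open>The coefficients will be summable, not merely bounded: the series then converges
  absolutely because the vectors have norm at most 1, and Bessel's inequality is avoided.\<close>

definition diag :: "(nat \<Rightarrow> real) \<Rightarrow> 'g l2 \<Rightarrow> 'g l2" where
  "diag a u = (\<Sum>i. scaleC (of_real (a i) * cinner (e i) u) (e i))"

context
  fixes a :: "nat \<Rightarrow> real"
  assumes nonneg: "a i \<ge> 0" and summ: "summable a"
begin

lemma norm_diag_term_le: "norm (scaleC (of_real (a i) * c) (e i)) \<le> a i * cmod c"
  using nonneg norm_e_le[of i] by (auto simp: norm_scaleC norm_mult intro!: mult_left_le)

lemma cmod_coeff_le: "cmod (cinner (e i) u) \<le> norm u"
  using norm_cinner_le[of "e i" u] mult_right_mono[OF norm_e_le[of i] norm_ge_zero[of u]] by simp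

lemma norm_diag_term_le': "norm (scaleC (of_real (a i) * cinner (e i) u) (e i)) \<le> a i * norm u"
  using norm_diag_term_le[of i "cinner (e i) u"] mult_left_mono[OF cmod_coeff_le[of i u] nonneg[of i]]
  by linarith

lemma summable_norm_diag: "summable (\<lambda>i. norm (scaleC (of_real (a i) * cinner (e i) u) (e i)))"
  by (rule summable_comparison_test'[OF summable_mult2[OF summ, of "norm u"], where N = 0])
     (simp add: norm_diag_term_le')

lemma summable_diag: "summable (\<lambda>i. scaleC (of_real (a i) * cinner (e i) u) (e i))"
  by (rule summable_norm_cancel[OF summable_norm_diag])

lemma bounded_op_diag: "bounded_op (diag a)"
proof (rule bounded_opI)
  fix u v and c
  show "diag a (u + v) = diag a u + diag a v"
    unfolding diag_def suminf_add[OF summable_diag summable_diag]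
    by (simp add: cinner_add_right ring_distribs scaleC_add_left)
  show "diag a (scaleC c u) = scaleC c (diag a u)"
    unfolding diag_def bounded_linear.suminf[OF bounded_bilinear.bounded_linear_right[OF bounded_bilinear_scaleC] summable_diag]
    by (simp add: cinner_scaleC_right mult.left_commute)
  have "norm (diag a u) \<le> (\<Sum>i. norm (scaleC (of_real (a i) * cinner (e i) u) (e i)))"
    unfolding diag_def by (rule summable_norm[OF summable_norm_diag])
  also have "\<dots> \<le> (\<Sum>i. a i * norm u)"
    by (intro suminf_le norm_diag_term_le' summable_norm_diag summable_mult2 summ)
  also have "\<dots> = norm u * (\<Sum>i. a i)"
    by (subst suminf_mult2[OF summ, symmetric]) (rule mult.commute)
  finally show "norm (diag a u) \<le> norm u * (\<Sum>i. a i)" .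
qed

lemma cinner_diag: "cinner (e i) (diag a u) = of_real (a i) * cinner (e i) u"
proof -
  have "cinner (e i) (diag a u) = (\<Sum>j. cinner (e i) (scaleC (of_real (a j) * cinner (e j) u) (e j)))"
    unfolding diag_def
    by (rule bounded_linear.suminf[OF bounded_bilinear.bounded_linear_right[OF bounded_bilinear_cinner] summable_diag])
  also have "\<dots> = (\<Sum>j\<in>{i}. cinner (e i) (scaleC (of_real (a j) * cinner (e j) u) (e j)))"
    by (rule suminf_finite) (auto simp: cinner_scaleC_right orth)
  also have "\<dots> = of_real (a i) * cinner (e i) u"
    using unit[of i] by (auto simp: cinner_scaleC_right)
  finally show ?thesis .
qed

lemma diag_e: "diag a (e j) = scaleC (of_real (a j)) (e j)"
  by (rule eqI) (use orth in \<open>auto simp: cinner_diag cinner_scaleC_right\<close>, metis)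

lemma diag_symmetric: "cinner (diag a u) v = cinner u (diag a v)"
proof -
  have bl: "bounded_linear (\<lambda>w. cinner w v)" "bounded_linear (cinner u)"
    by (rule bounded_bilinear.bounded_linear_left[OF bounded_bilinear_cinner]
          bounded_bilinear.bounded_linear_right[OF bounded_bilinear_cinner])+
  show ?thesis
    unfolding diag_def bounded_linear.suminf[OF bl(1) summable_diag] bounded_linear.suminf[OF bl(2) summable_diag]
    by (intro suminf_cong)
       (simp add: cinner_scaleC_left cinner_scaleC_right cinner_commute[of u])
qed

text \<open>The image of the unit ball lies in a continuous image of a product of closed unit discs,
  namely that of all possible sequences of coefficients.\<close>

lemma compact_op_diag: "compact_op (diag a)"
proof -
  let ?K = "PiE UNIV (\<lambda>_::nat. cball (0::complex) 1)"
  let ?F = "\<lambda>c::nat \<Rightarrow> complex. \<Sum>i. scaleC (of_real (a i) * c i) (e i)"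
  have K: "compact ?K"
    using compactin_PiE[of "\<lambda>_. euclidean" UNIV "\<lambda>_::nat. cball (0::complex) 1"]
    by (simp add: euclidean_product_topology)
  have bound: "norm (scaleC (of_real (a i) * c i) (e i)) \<le> a i" if "c \<in> ?K" for c i
  proof -
    have "cmod (c i) \<le> 1" using that by (auto simp: PiE_iff)
    then show ?thesis
      using norm_diag_term_le[of i "c i"] mult_left_le[OF _ nonneg[of i], of "cmod (c i)"] by linarith
  qed
  have "continuous_on ?K ?F"
  proof (rule uniform_limit_theorem)
    show "uniform_limit ?K (\<lambda>n c. \<Sum>i<n. scaleC (of_real (a i) * c i) (e i)) ?F sequentially"
      by (rule Weierstrass_m_test[OF bound summ])
    show "\<forall>\<^sub>F n in sequentially. continuous_on ?K (\<lambda>c. \<Sum>i<n. scaleC (of_real (a i) * c i) (e i))"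
      by (intro always_eventually allI continuous_on_sum
          bounded_bilinear.continuous_on[OF bounded_bilinear_scaleC] continuous_intros
          continuous_on_subset[OF continuous_on_product_coordinates]) auto
  qed auto
  then have c: "compact (?F ` ?K)" using K by (rule compact_continuous_image)
  have "diag a ` cball 0 1 \<subseteq> ?F ` ?K"
  proof
    fix v assume "v \<in> diag a ` cball 0 1"
    then obtain u where u: "v = diag a u" "norm u \<le> 1" by auto
    have "(\<lambda>i. cinner (e i) u) \<in> ?K" using order_trans[OF cmod_coeff_le u(2)] by auto
    then show "v \<in> ?F ` ?K" unfolding u(1) diag_def by (intro image_eqI[where x = "\<lambda>i. cinner (e i) u"]) auto
  qed
  then have "closure (diag a ` cball 0 1) \<subseteq> ?F ` ?K"
    by (intro closure_minimal compact_imp_closed c)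
  then have "?F ` ?K \<inter> closure (diag a ` cball 0 1) = closure (diag a ` cball 0 1)"
    by (rule Int_absorb1)
  then have "compact (closure (diag a ` cball 0 1))"
    using compact_Int_closed[OF c closed_closure] by (rule subst)
  then show ?thesis unfolding compact_op_def using bounded_op_diag by blast
qed

end

end

section \<open>The Dirac operator as the inverse of a diagonal operator\<close>

locale dirac = total_orthonormal_sequence e for e :: "nat \<Rightarrow> 'g::topological_group_add l2" +
  fixes \<mu> :: "nat \<Rightarrow> real"
  assumes \<mu>_pos: "\<mu> i > 0" and summable_powr: "s > 0 \<Longrightarrow> summable (\<lambda>i. \<mu> i powr s)"
begin

lemma summable_\<mu>: "summable \<mu>"
  using summable_powr[of 1] \<mu>_pos by (simp add: less_imp_le)

lemmas \<mu>_nonneg = less_imp_le[OF \<mu>_pos]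

abbreviation "T \<equiv> diag \<mu>"

text \<open>\<open>D\<close> has domain \<open>range T\<close> and eigenvalues
  \<open>1 / \<mu> i\<close>, so |D|^-s is diagonal with entries \<open>\<mu> i powr s\<close>; this
  is why the locale asks for summability of all positive powers.\<close>

definition "D = inv_into UNIV T"

lemmas bounded_T = bounded_op_diag[OF \<mu>_nonneg summable_\<mu>]
lemmas T_symmetric = diag_symmetric[OF \<mu>_nonneg summable_\<mu>]
lemmas cinner_T = cinner_diag[OF \<mu>_nonneg summable_\<mu>]

lemma inj_T: "inj T"
proof
  fix u v assume *: "T u = T v"
  show "u = v"
  proof (rule eqI)
    fix i show "cinner (e i) u = cinner (e i) v"
      using arg_cong[OF *, of "cinner (e i)"] \<mu>_pos[of i] by (simp add: cinner_T)
  qed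
qed

lemma D_T [simp]: "D (T u) = u"
  unfolding D_def by (rule inv_f_f[OF inj_T])

lemma csubspace_range_T: "csubspace (range T)"
  unfolding csubspace_def
  using bounded_op_add[OF bounded_T, symmetric] bounded_op_scaleC[OF bounded_T, symmetric]
    bounded_op_0[OF bounded_T, symmetric] by (auto simp: image_iff)

lemma e_in_range_T: "e i \<in> range T"
proof -
  have "T (scaleC (of_real (1 / \<mu> i)) (e i)) = e i"
    using \<mu>_pos[of i]
    by (simp add: bounded_op_scaleC[OF bounded_T] diag_e[OF \<mu>_nonneg summable_\<mu>] flip: of_real_mult)
  then show ?thesis by (metis rangeI)
qed

lemma closure_range_T: "closure (range T) = UNIV"
proof -
  have "csubspace hull (range e) \<subseteq> range T"
    using e_in_range_T csubspace_range_T by (intro hull_minimal) auto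
  from closure_mono[OF this] show ?thesis using total by auto
qed

lemma self_adjoint_D: "self_adjoint (range T) D"
  unfolding self_adjoint_def
proof (intro conjI allI csubspace_range_T closure_range_T)
  show "clinear_on (range T) D"
    unfolding clinear_on_def
    by (auto simp flip: bounded_op_add[OF bounded_T] bounded_op_scaleC[OF bounded_T])
  fix u w
  show "u \<in> range T \<and> w = D u \<longleftrightarrow> (\<forall>v\<in>range T. cinner (D v) u = cinner v w)"
  proof
    assume "\<forall>v\<in>range T. cinner (D v) u = cinner v w"
    \<comment> \<open>Every element of the domain is \<open>T x\<close> with
      \<open>D (T x) = x\<close>, so by symmetry of \<open>T\<close> the adjoint relation becomes a
      statement about all vectors x.\<close>
    then have "cinner v u = cinner v (T w)" for v by (simp add: T_symmetric)
    then have "u = T w" by (intro eqI)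
    then show "u \<in> range T \<and> w = D u" by simp
  qed (auto simp: T_symmetric)
qed

lemma compact_resolvent_D: "compact_resolvent (range T) D"
  unfolding compact_resolvent_def is_resolvent_def
  by (rule exI[of _ 0], rule exI[of _ T])
     (auto simp: bounded_T intro: compact_op_diag[OF \<mu>_nonneg summable_\<mu>])

text \<open>The definition speaks of all eigenvectors, not only of the \<open>e i\<close>. An
  eigenvector for r has nonzero coefficients only where \<open>\<mu> i * r = 1\<close>, and there
  \<open>\<mu> i powr s\<close> is |r|^-s, so comparing coefficients suffices.\<close>

lemma is_abs_powr_D:
  assumes "s > 0"
  shows "is_abs_powr (range T) D s (diag (\<lambda>i. \<mu> i powr s))"
  unfolding is_abs_powr_def
proof (intro conjI allI impI)
  note dg = bounded_op_diag cinner_diag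
  note dg = dg[OF powr_ge_zero summable_powr[OF assms]]
  show b: "bounded_op (diag (\<lambda>i. \<mu> i powr s))" by (rule dg)
  fix r u assume "u \<in> range T \<and> D u = r *\<^sub>R u"
  then have u: "u = T (scaleC (of_real r) u)" by (auto simp: scaleC_of_real)
  show "diag (\<lambda>i. \<mu> i powr s) u = (if r = 0 then 0 else (\<bar>r\<bar> powr (- s)) *\<^sub>R u)"
  proof (cases "r = 0")
    \<comment> \<open>Here \<open>u = T 0 = 0\<close>: the kernel of \<open>D\<close> is
      trivial.\<close>
    case True
    then show ?thesis using u by (simp add: bounded_op_0[OF bounded_T] bounded_op_0[OF b])
  next
    case False
    have "diag (\<lambda>i. \<mu> i powr s) u = scaleC (of_real (\<bar>r\<bar> powr (- s))) u"
    proof (rule eqI)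
      fix i
      have "cinner (e i) u = of_real (\<mu> i * r) * cinner (e i) u"
        using arg_cong[OF u, of "cinner (e i)"] by (simp add: cinner_T cinner_scaleC_right)
      then consider "cinner (e i) u = 0" | "\<mu> i * r = 1"
        by (metis mult_cancel_right1 of_real_eq_1_iff)
      then show "cinner (e i) (diag (\<lambda>i. \<mu> i powr s) u)
          = cinner (e i) (scaleC (of_real (\<bar>r\<bar> powr (- s))) u)"
      proof cases
        case 2
        then have r: "\<bar>r\<bar> = inverse (\<mu> i)" using \<mu>_pos[of i]
          by (simp add: inverse_eq_divide eq_divide_eq abs_mult abs_if mult.commute split: if_splits)
             (smt (verit) mult_neg_pos)
        have "\<bar>r\<bar> powr (- s) = \<mu> i powr s"
          unfolding r using \<mu>_pos[of i] by (simp add: powr_minus inverse_powr[symmetric])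
        then show ?thesis by (simp add: dg cinner_scaleC_right)
      qed (simp add: dg cinner_scaleC_right)
    qed
    then show ?thesis using False by (simp add: scaleC_of_real)
  qed
qed

lemma s_summable_D:
  assumes "s > 0"
  shows "s_summable (range T) D s"
  unfolding s_summable_def finite_trace_def
proof (intro exI conjI)
  note dg = diag_e[OF powr_ge_zero summable_powr[OF assms]]
  show "is_abs_powr (range T) D s (diag (\<lambda>i. \<mu> i powr s))" by (rule is_abs_powr_D[OF assms])
  show "orthonormal_basis (range e - {0})"
    unfolding orthonormal_basis_def
  proof (intro conjI ballI)
    fix u v assume "u \<in> range e - {0}" "v \<in> range e - {0}"
    then obtain i j where "u = e i" "v = e j" "e i \<noteq> 0" "e j \<noteq> 0" by auto
    then show "cinner u v = (if u = v then 1 else 0)"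
      using unit[of i] orth[of i j] by (cases "i = j") auto
  next
    have "range e \<subseteq> csubspace hull (range e - {0})"
      using hull_subset[of "range e - {0}" csubspace] csubspace_hull[of "range e - {0}"]
      by (auto simp: csubspace_def)
    then have "csubspace hull (range e) \<subseteq> csubspace hull (range e - {0})"
      by (intro hull_minimal csubspace_hull)
    from closure_mono[OF this] show "closure (csubspace hull (range e - {0})) = UNIV"
      using total by auto
  qed
  \<comment> \<open>Away from the zero vectors \<open>e\<close> is injective, since equal unit
    vectors at different indices would be orthogonal to themselves. The trace can therefore be
    summed over indices.\<close>
  define I where "I = {i. e i \<noteq> 0}"
  have *: "range e - {0} = e ` I" "inj_on e I"
  proof -
    show "inj_on e I" using orth unit by (intro inj_onI) (metis I_def mem_Collect_eq one_neq_zero)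
  qed (auto simp: I_def)
  have "(\<lambda>i. complex_of_real (\<mu> i powr s)) summable_on I"
  proof -
    have "(\<lambda>i. \<mu> i powr s) summable_on UNIV"
      using summable_powr[OF assms] by (intro norm_summable_imp_summable_on) simp
    then have "(\<lambda>i. \<mu> i powr s) summable_on I" by (rule summable_on_subset_banach) simp
    then show ?thesis by (rule summable_on_of_real)
  qed
  then have "((\<lambda>u. cinner u (diag (\<lambda>i. \<mu> i powr s) u)) \<circ> e) summable_on I"
    by (rule summable_on_cong[THEN iffD1, rotated])
       (use unit in \<open>auto simp: I_def dg cinner_scaleC_right\<close>)
  then show "(\<lambda>u. cinner u (diag (\<lambda>i. \<mu> i powr s) u)) summable_on (range e - {0})"
    unfolding *(1) summable_on_reindex[OF *(2)] .
qed

text \<open>Formally [D, A] has the entries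
  \<open>(1 / \<mu> i - 1 / \<mu> j) * cinner (e i) (A (e j))\<close>. Outside the square of indices
  below \<open>m\<close> either the first factor or, by \<open>block\<close>, the second one
  vanishes, so the commutator is a finite sum of rank-one operators.\<close>

lemma bounded_commutator:
  assumes A: "bounded_op A"
    and block: "\<And>i j. i \<ge> m \<or> j \<ge> m \<Longrightarrow> \<mu> i \<noteq> \<mu> j \<Longrightarrow> cinner (e i) (A (e j)) = 0"
  shows "A ` range T \<subseteq> range T \<and>
    (\<exists>C. bounded_op C \<and> (\<forall>u\<in>range T. C u = D (A u) - A (D u)))"
proof -
  define C where "C u = (\<Sum>i<m. \<Sum>j<m.
    scaleC (of_real (1 / \<mu> i - 1 / \<mu> j) * cinner (e i) (A (e j)) * cinner (e j) u) (e i))" for u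
  have C: "bounded_op C"
    unfolding C_def by (intro bounded_op_sum bounded_op_rank_one)
  have Cij: "cinner (e i) (C (e j)) = of_real (1 / \<mu> i - 1 / \<mu> j) * cinner (e i) (A (e j))" for i j
  proof (cases "e i = 0 \<or> e j = 0")
    case True
    then show ?thesis using bounded_op_0[OF A] bounded_op_0[OF C] by auto
  next
    case False
    have d: "cinner (e i) (e j) = (if i = j then 1 else 0)" if "e i \<noteq> 0" for i j
      using orth unit that by auto
    have "cinner (e i) (C (e j)) = (\<Sum>i'<m. \<Sum>j'<m. if i' = i \<and> j' = j then
        of_real (1 / \<mu> i - 1 / \<mu> j) * cinner (e i) (A (e j)) else 0)"
      unfolding C_def cinner_sum_right
      by (intro sum.cong refl) (use False orth[of i] orth[of _ j] d in \<open>auto simp: cinner_scaleC_right\<close>)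
    also have "\<dots> = (\<Sum>i'<m. if i' = i then (\<Sum>j'<m. if j' = j then
        of_real (1 / \<mu> i - 1 / \<mu> j) * cinner (e i) (A (e j)) else 0) else 0)"
      by (intro sum.cong refl) auto
    also have "\<dots> = (if i < m \<and> j < m then of_real (1 / \<mu> i - 1 / \<mu> j) * cinner (e i) (A (e j)) else 0)"
      by simp
    also have "\<dots> = of_real (1 / \<mu> i - 1 / \<mu> j) * cinner (e i) (A (e j))"
      using block[of i j] by (cases "\<mu> i = \<mu> j") auto
    finally show ?thesis .
  qed
  \<comment> \<open>This is [D, A] = C multiplied by \<open>T\<close> on both sides, so only bounded
    operators occur. Its right-hand side lies in \<open>range T\<close>, which gives the invariance
    of the domain.\<close>
  have "(\<lambda>u. A (T u)) = (\<lambda>u. T (A u + C (T u)))"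
  proof (rule op_eqI)
    fix i j
    have r: "\<mu> i * (1 + \<mu> j * (1 / \<mu> i - 1 / \<mu> j)) = \<mu> j"
      using \<mu>_pos[of i] \<mu>_pos[of j] by (simp add: field_simps)
    have "of_real (\<mu> i) * (c + of_real (\<mu> j) * (of_real t * c))
        = of_real (\<mu> i * (1 + \<mu> j * t)) * c" for c :: complex and t
      by (simp add: algebra_simps)
    note * = this[of _ "1 / \<mu> i - 1 / \<mu> j", unfolded r]
    show "cinner (e i) (A (T (e j))) = cinner (e i) (T (A (e j) + C (T (e j))))"
      by (simp only: cinner_T cinner_add_right cinner_scaleC_right diag_e[OF \<mu>_nonneg summable_\<mu>]
          bounded_op_scaleC[OF A] bounded_op_scaleC[OF C] Cij *)
  qed (intro bounded_op_compose[OF A] bounded_op_compose[OF bounded_T] bounded_op_plus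
         bounded_op_compose[OF C] A bounded_T)+
  then have AT: "A (T u) = T (A u + C (T u))" for u by metis
  then have "A (T u) \<in> range T" "D (A (T u)) = A u + C (T u)" for u by simp_all
  then show ?thesis using C by (intro conjI exI[of _ C]) auto
qed

text \<open>Matrix entries survive only between equal eigenvalues, so A commutes with
  \<open>T\<close>, and therefore with its inverse on the range.\<close>

lemma commute_D:
  assumes A: "bounded_op A"
    and block: "\<And>i j. \<mu> i \<noteq> \<mu> j \<Longrightarrow> cinner (e i) (A (e j)) = 0"
    and u: "u \<in> range T"
  shows "A u \<in> range T \<and> D (A u) = A (D u)"
proof -
  have "(\<lambda>u. A (T u)) = (\<lambda>u. T (A u))"
  proof (rule op_eqI)
    fix i j
    show "cinner (e i) (A (T (e j))) = cinner (e i) (T (A (e j)))"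
      using block[of i j]
      by (cases "\<mu> i = \<mu> j")
         (auto simp: cinner_T cinner_scaleC_right diag_e[OF \<mu>_nonneg summable_\<mu>] bounded_op_scaleC[OF A])
  qed (rule bounded_op_compose[OF A bounded_T] bounded_op_compose[OF bounded_T A])+
  then have "A (T u) = T (A u)" for u by metis
  then show ?thesis using u by auto
qed

end

text \<open>Gram--Schmidt. Since \<open>sgn 0 = 0\<close>, a vector that depends on its predecessors
  yields 0 instead of being dropped, so the indices of \<open>g\<close> are kept.\<close>

fun orthonormalize :: "(nat \<Rightarrow> 'g::topological_group_add l2) \<Rightarrow> nat \<Rightarrow> 'g l2" where
  "orthonormalize g n =
     sgn (g n - (\<Sum>j<n. scaleC (cinner (orthonormalize g j) (g n)) (orthonormalize g j)))"

declare orthonormalize.simps [simp del]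

lemma orthonormalize_unit: "orthonormalize g n = 0 \<or> cinner (orthonormalize g n) (orthonormalize g n) = 1"
  by (subst (1 2 3) orthonormalize.simps) (simp add: cinner_self norm_sgn sgn_zero_iff)

lemma orthonormalize_orth_less: "i < n \<Longrightarrow> cinner (orthonormalize g i) (orthonormalize g n) = 0"
proof (induction n arbitrary: i rule: less_induct)
  case (less n)
  let ?e = "orthonormalize g"
  have o: "cinner (?e i) (?e j) = 0" if "j < n" "j \<noteq> i" for j
    using less.IH[of j i] less.IH[of i j] less.prems that cinner_commute[of "?e i" "?e j"]
    by (cases "i < j") auto
  \<comment> \<open>Only the term \<open>j = i\<close> survives; if that vector is zero, both sides
    vanish.\<close>
  have "cinner (?e i) (\<Sum>j<n. scaleC (cinner (?e j) (g n)) (?e j))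
      = (\<Sum>j<n. if j = i then cinner (?e i) (g n) * cinner (?e i) (?e i) else 0)"
    unfolding cinner_sum_right by (intro sum.cong) (auto simp: cinner_scaleC_right o)
  also have "\<dots> = cinner (?e i) (g n)"
    using less.prems orthonormalize_unit[of g i] by auto
  finally show ?case
    by (subst (2) orthonormalize.simps)
       (simp add: sgn_div_norm bounded_bilinear.scaleR_right[OF bounded_bilinear_cinner]
          bounded_bilinear.diff_right[OF bounded_bilinear_cinner])
qed

lemma orthonormalize_orth: "i \<noteq> j \<Longrightarrow> cinner (orthonormalize g i) (orthonormalize g j) = 0"
  using orthonormalize_orth_less[of i j g] orthonormalize_orth_less[of j i g]
    cinner_commute[of "orthonormalize g i" "orthonormalize g j"]
  by (cases "i < j") auto

lemma orthonormalize_in_csubspace: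
  assumes "csubspace V" "\<And>i. i < n \<Longrightarrow> g i \<in> V"
  shows "i < n \<Longrightarrow> orthonormalize g i \<in> V"
proof (induction i rule: less_induct)
  case (less i)
  then show ?case
    by (subst orthonormalize.simps)
       (use assms in \<open>auto simp: sgn_div_norm csubspace_def intro!: csubspace_scaleR csubspace_minus csubspace_sum\<close>)
qed

text \<open>Gram--Schmidt is triangular: \<open>g i\<close> is its residual plus a combination of
  earlier vectors. Hence nothing of the span is lost, index by index, although some of the vectors
  may be zero.\<close>

lemma in_hull_orthonormalize:
  "g i \<in> csubspace hull (orthonormalize g ` {..i})"
proof -
  let ?e = "orthonormalize g" and ?W = "csubspace hull (orthonormalize g ` {..i})"
  define w where "w = g i - (\<Sum>j<i. scaleC (cinner (?e j) (g i)) (?e j))"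
  have W: "csubspace ?W" by (rule csubspace_hull)
  have e: "?e j \<in> ?W" if "j \<le> i" for j using that by (intro hull_inc) auto
  have "w = norm w *\<^sub>R ?e i"
    by (subst orthonormalize.simps) (cases "w = 0"; simp add: w_def[symmetric] sgn_div_norm)
  moreover have "norm w *\<^sub>R ?e i \<in> ?W" by (intro csubspace_scaleR W e) simp
  ultimately have "w \<in> ?W" by (rule ssubst)
  moreover have "(\<Sum>j<i. scaleC (cinner (?e j) (g i)) (?e j)) \<in> ?W"
    using W e by (intro csubspace_sum) (auto simp: csubspace_def)
  ultimately have "w + (\<Sum>j<i. scaleC (cinner (?e j) (g i)) (?e j)) \<in> ?W"
    using W by (auto simp: csubspace_def)
  then show ?thesis by (simp add: w_def)
qed


section \<open>Haar measure of a profinite group\<close>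

text \<open>The sequence need not decrease strictly, so finite groups are included.\<close>

locale subgroup_filtration =
  fixes N :: "nat \<Rightarrow> 'g::topological_group_add set"
  assumes compact_UNIV: "compact (UNIV :: 'g set)"
    and open_N: "open (N k)"
    and zero_N: "0 \<in> N k"
    and add_N: "x \<in> N k \<Longrightarrow> y \<in> N k \<Longrightarrow> x + y \<in> N k"
    and uminus_N: "x \<in> N k \<Longrightarrow> - x \<in> N k"
    and normal_N: "x \<in> N k \<Longrightarrow> y + x - y \<in> N k"
    and decseq_N: "decseq N"
    and base_N: "open U \<Longrightarrow> 0 \<in> U \<Longrightarrow> \<exists>k. N k \<subseteq> U"
begin

text \<open>These are the functions on the finite quotient by \<open>N k\<close>. The codomain is
  arbitrary so that predicates can be inserted: for \<open>\<lambda>x. x \<in> A\<close> the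
  condition says that \<open>A\<close> is a union of cosets.\<close>

definition invariant :: "nat \<Rightarrow> ('g \<Rightarrow> 'b) \<Rightarrow> bool" where
  "invariant k f \<longleftrightarrow> (\<forall>x. \<forall>h\<in>N k. f (x + h) = f x)"

definition coset :: "nat \<Rightarrow> 'g \<Rightarrow> 'g set" where
  "coset k x = {y. - x + y \<in> N k}"

lemma invariant_mono: "invariant k f \<Longrightarrow> k \<le> l \<Longrightarrow> invariant l f"
  using decseqD[OF decseq_N, of k l] by (auto simp: invariant_def)

lemma invariant_comp: "invariant k f \<Longrightarrow> invariant k (\<lambda>x. F (f x))"
  by (auto simp: invariant_def)

lemma invariant_comp2: "invariant k f \<Longrightarrow> invariant k g \<Longrightarrow> invariant k (\<lambda>x. F (f x) (g x))"
  by (auto simp: invariant_def)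

lemma invariant_translate_left: "invariant k f \<Longrightarrow> invariant k (\<lambda>x. f (z + x))"
  by (auto simp: invariant_def simp flip: add.assoc)

text \<open>Here normality enters: adding \<open>h\<close> and then \<open>z\<close> is the same as
  adding \<open>z\<close> and then the conjugate of \<open>h\<close> by \<open>- z\<close>, which is
  again in \<open>N k\<close>.\<close>

lemma invariant_translate_right:
  assumes "invariant k f" shows "invariant k (\<lambda>x. f (x + z))"
  unfolding invariant_def
proof (intro allI ballI)
  fix x h assume "h \<in> N k"
  then have "- z + h - (- z) \<in> N k" by (rule normal_N)
  then have "f (x + z + (- z + h - (- z))) = f (x + z)" using assms by (auto simp: invariant_def)
  then show "f (x + h + z) = f (x + z)" by (simp add: add.assoc)
qed

section \<open>Cosets of the subgroups\<close>

lemma in_coset_self [simp]: "x \<in> coset k x"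
  by (simp add: coset_def zero_N)

lemma coset_eq_iff: "coset k x = coset k y \<longleftrightarrow> - x + y \<in> N k"
proof
  assume h: "- x + y \<in> N k"
  have "- x + z \<in> N k \<longleftrightarrow> - y + z \<in> N k" for z
  proof
    assume "- x + z \<in> N k"
    then have "- (- x + y) + (- x + z) \<in> N k" by (rule add_N[OF uminus_N[OF h]])
    then show "- y + z \<in> N k" by (simp add: minus_add add.assoc)
  next
    assume "- y + z \<in> N k"
    then have "(- x + y) + (- y + z) \<in> N k" by (rule add_N[OF h])
    then show "- x + z \<in> N k" by (simp add: add.assoc)
  qed
  then show "coset k x = coset k y" by (auto simp: coset_def)
qed (metis in_coset_self coset_def mem_Collect_eq)

lemma in_coset_iff: "y \<in> coset k x \<longleftrightarrow> coset k y = coset k x"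
  using coset_eq_iff[of k x y] by (auto simp: coset_def)

lemma open_coset: "open (coset k x)"
proof -
  have "coset k x = (\<lambda>y. - x + y) -` N k" by (auto simp: coset_def)
  then show ?thesis
    using open_N by (auto intro!: open_vimage continuous_intros)
qed

lemma invariant_iff_coset: "invariant k f \<longleftrightarrow> (\<forall>x y. coset k x = coset k y \<longrightarrow> f x = f y)"
proof
  assume f: "invariant k f"
  show "\<forall>x y. coset k x = coset k y \<longrightarrow> f x = f y"
  proof (intro allI impI)
    fix x y assume "coset k x = coset k y"
    then have "f (x + (- x + y)) = f x" using f unfolding coset_eq_iff invariant_def by blast
    then show "f x = f y" by (simp add: add.assoc[symmetric])
  qed
next
  assume *: "\<forall>x y. coset k x = coset k y \<longrightarrow> f x = f y"
  show "invariant k f"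
    unfolding invariant_def
  proof (intro allI ballI)
    fix x h assume "h \<in> N k"
    then have "coset k x = coset k (x + h)" by (simp add: coset_eq_iff add.assoc[symmetric])
    then show "f (x + h) = f x" by (rule *[rule_format, symmetric])
  qed
qed

lemma invariant_coset: "invariant k (\<lambda>x. x \<in> coset k y)"
  by (auto simp: invariant_iff_coset in_coset_iff)

lemma coset_subset_iff:
  assumes "invariant k (\<lambda>x. x \<in> A)"
  shows "coset k x \<subseteq> A \<longleftrightarrow> x \<in> A"
proof
  assume "x \<in> A"
  show "coset k x \<subseteq> A"
  proof
    fix y assume "y \<in> coset k x"
    then have "coset k y = coset k x" by (simp only: in_coset_iff)
    with assms have "(y \<in> A) = (x \<in> A)" unfolding invariant_iff_coset by blast
    with \<open>x \<in> A\<close> show "y \<in> A" by blast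
  qed
qed (use in_coset_self in blast)

lemma open_invariant: "invariant k (\<lambda>x. x \<in> A) \<Longrightarrow> open A"
proof -
  assume "invariant k (\<lambda>x. x \<in> A)"
  then have "A = (\<Union>x\<in>A. coset k x)"
    using coset_subset_iff in_coset_self by blast
  moreover have "open (\<Union>x\<in>A. coset k x)" using open_coset by blast
  ultimately show "open A" by (rule ssubst)
qed

lemma continuous_on_invariant:
  assumes "invariant k f" shows "continuous_on UNIV f"
proof -
  have "open (f -` B)" for B
  proof -
    have "invariant k (\<lambda>x. x \<in> f -` B)"
      using invariant_comp[OF assms, of "\<lambda>y. y \<in> B"] by simp
    then show ?thesis by (rule open_invariant)
  qed
  then show ?thesis by (simp add: continuous_on_open_vimage)
qed

lemma closed_invariant: "invariant k (\<lambda>x. x \<in> A) \<Longrightarrow> closed A"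
  unfolding closed_def by (rule open_invariant[of k]) (auto dest: invariant_comp[where F = Not])

text \<open>The cosets form an open cover of a compact space, and each coset is determined by any of
  its points.\<close>

lemma finite_cosets: "finite (range (coset k))"
proof -
  obtain F where F: "finite F" "UNIV \<subseteq> (\<Union>x\<in>F. coset k x)"
  proof (rule compactE_image[OF compact_UNIV, of UNIV "coset k"])
    show "UNIV \<subseteq> (\<Union>x. coset k x)" using in_coset_self by blast
  qed (auto simp: open_coset)
  have "range (coset k) \<subseteq> coset k ` F"
  proof
    fix c assume "c \<in> range (coset k)"
    then obtain y where y: "c = coset k y" by blast
    obtain x where "x \<in> F" "y \<in> coset k x" using F(2) by blast
    then show "c \<in> coset k ` F" unfolding y in_coset_iff by (rule rev_image_eqI)
  qed
  then show ?thesis using F(1) finite_surj by blast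
qed

lemma translate_coset: "(+) z ` coset k x = coset k (z + x)"
proof -
  have "y \<in> (+) z ` coset k x" if "- (z + x) + y \<in> N k" for y
  proof (rule image_eqI)
    show "y = z + (- z + y)" by (simp add: add.assoc[symmetric])
    show "- z + y \<in> coset k x" using that by (simp only: coset_def minus_add add.assoc mem_Collect_eq)
  qed
  moreover have "- (z + x) + (z + y) = - x + y" for y
    by (simp only: minus_add add.assoc) (simp add: add.assoc[symmetric])
  ultimately show ?thesis by (auto simp: coset_def)
qed

section \<open>Counting cosets\<close>

definition cosets_in :: "nat \<Rightarrow> 'g set \<Rightarrow> 'g set set" where
  "cosets_in k A = {c \<in> range (coset k). c \<subseteq> A}"

text \<open>The normalized counting measure of the quotient by \<open>N k\<close>, pulled back to
  the group; on sets invariant at level k it is the only possible value of an invariant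
  probability.\<close>

definition weight :: "nat \<Rightarrow> 'g set \<Rightarrow> real" where
  "weight k A = card (cosets_in k A) / card (range (coset k))"

lemma finite_cosets_in: "finite (cosets_in k A)"
  using finite_cosets by (simp add: cosets_in_def)

lemma cosets_in_UNIV: "cosets_in k UNIV = range (coset k)"
  by (simp add: cosets_in_def)

lemma card_cosets_pos: "card (range (coset k)) > 0"
  using finite_cosets by (simp add: card_gt_0_iff)

lemma weight_UNIV: "weight k UNIV = 1"
  using card_cosets_pos[of k] by (simp add: weight_def cosets_in_UNIV)

lemma weight_nonneg: "weight k A \<ge> 0"
  by (simp add: weight_def)

lemma weight_empty: "weight k {} = 0"
proof -
  have "cosets_in k {} = {}" using in_coset_self unfolding cosets_in_def by blast
  then show ?thesis by (simp add: weight_def)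
qed

lemma cosets_in_Un:
  assumes "invariant k (\<lambda>x. x \<in> A)" "invariant k (\<lambda>x. x \<in> B)"
  shows "cosets_in k (A \<union> B) = cosets_in k A \<union> cosets_in k B"
proof -
  have "invariant k (\<lambda>x. x \<in> A \<union> B)" using invariant_comp2[OF assms, of "(\<or>)"] by simp
  then have "coset k x \<subseteq> A \<union> B \<longleftrightarrow> coset k x \<subseteq> A \<or> coset k x \<subseteq> B" for x
    by (simp only: coset_subset_iff assms Un_iff)
  then show ?thesis unfolding cosets_in_def by blast
qed

lemma cosets_in_disjoint: "A \<inter> B = {} \<Longrightarrow> cosets_in k A \<inter> cosets_in k B = {}"
  using in_coset_self unfolding cosets_in_def by blast

lemma weight_Un:
  assumes "invariant k (\<lambda>x. x \<in> A)" "invariant k (\<lambda>x. x \<in> B)" "A \<inter> B = {}"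
  shows "weight k (A \<union> B) = weight k A + weight k B"
  using cosets_in_disjoint[OF assms(3), of k]
  by (simp add: weight_def cosets_in_Un[OF assms(1,2)] card_Un_disjoint finite_cosets_in add_divide_distrib)

text \<open>Translation by \<open>z\<close> injects the cosets in \<open>A\<close> into those in the
  translate; translating back by \<open>- z\<close> gives the other inequality.\<close>

lemma card_cosets_in_translate: "card (cosets_in k ((+) z ` A)) = card (cosets_in k A)"
proof -
  have inj: "inj_on (image ((+) z)) S" for z and S :: "'g set set"
    by (auto intro!: inj_onI simp: inj_image_eq_iff)
  have sub: "image ((+) z) ` cosets_in k A \<subseteq> cosets_in k ((+) z ` A)" for z A
    by (auto simp: cosets_in_def translate_coset)
  have "card (cosets_in k A) \<le> card (cosets_in k ((+) z ` A))" for z A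
    by (rule card_inj_on_le[OF inj sub finite_cosets_in])
  from this[of A z] this[of "(+) z ` A" "- z"] show ?thesis
    by (simp add: image_image add.assoc[symmetric])
qed

lemma card_cosets_in_coset: "card (cosets_in l (coset k x)) = card (cosets_in l (coset k 0))"
  using card_cosets_in_translate[of l x "coset k 0"] by (simp add: translate_coset)

text \<open>The cosets of \<open>N k\<close> are translates of one another, so each of them contains
  equally many cosets of the smaller subgroup \<open>N l\<close>.\<close>

lemma card_cosets_in_refine:
  assumes A: "invariant k (\<lambda>x. x \<in> A)" and "k \<le> l"
  shows "card (cosets_in l A) = card (cosets_in k A) * card (cosets_in l (coset k 0))"
proof -
  have lk: "coset l x \<subseteq> coset k x" for x
    using decseqD[OF decseq_N \<open>k \<le> l\<close>] by (auto simp: coset_def)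
  have "cosets_in l A = (\<Union>c\<in>cosets_in k A. cosets_in l c)"
  proof (intro equalityI subsetI)
    fix d assume "d \<in> cosets_in l A"
    then obtain x where x: "d = coset l x" "d \<subseteq> A" by (auto simp: cosets_in_def)
    then have "coset k x \<in> cosets_in k A"
      using coset_subset_iff[OF A, of x] in_coset_self[of x l] by (auto simp: cosets_in_def simp del: in_coset_self)
    moreover have "d \<in> cosets_in l (coset k x)" using x lk by (auto simp: cosets_in_def)
    ultimately show "d \<in> (\<Union>c\<in>cosets_in k A. cosets_in l c)" by blast
  qed (auto simp: cosets_in_def)
  moreover have "disjoint_family_on (cosets_in l) (cosets_in k A)"
    unfolding disjoint_family_on_def
  proof (intro ballI impI cosets_in_disjoint)
    fix c d assume "c \<in> cosets_in k A" "d \<in> cosets_in k A" "c \<noteq> d"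
    then show "c \<inter> d = {}" by (auto simp: cosets_in_def in_coset_iff)
  qed
  ultimately have "card (cosets_in l A) = (\<Sum>c\<in>cosets_in k A. card (cosets_in l c))"
    by (simp add: card_UN_disjoint' finite_cosets_in)
  also have "\<dots> = (\<Sum>c\<in>cosets_in k A. card (cosets_in l (coset k 0)))"
  proof (rule sum.cong[OF refl])
    fix c assume "c \<in> cosets_in k A"
    then obtain x where x: "c = coset k x" unfolding cosets_in_def by blast
    show "card (cosets_in l c) = card (cosets_in l (coset k 0))"
      unfolding x by (rule card_cosets_in_coset)
  qed
  finally show ?thesis by simp
qed

lemma weight_refine:
  assumes "invariant k (\<lambda>x. x \<in> A)" "k \<le> l"
  shows "weight l A = weight k A"
proof -
  have "card (range (coset l)) = card (range (coset k)) * card (cosets_in l (coset k 0))"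
    using card_cosets_in_refine[of k UNIV l] assms(2) by (simp add: cosets_in_UNIV invariant_def)
  then show ?thesis
    using card_cosets_pos[of l] card_cosets_in_refine[OF assms] by (simp add: weight_def)
qed

section \<open>The algebra of sets of finite level\<close>

definition clopens :: "'g set set" where
  "clopens = {A. \<exists>k. invariant k (\<lambda>x. x \<in> A)}"

lemma common_level:
  assumes "A \<in> clopens" "B \<in> clopens"
  obtains k where "invariant k (\<lambda>x. x \<in> A)" "invariant k (\<lambda>x. x \<in> B)"
proof -
  obtain i j where "invariant i (\<lambda>x. x \<in> A)" "invariant j (\<lambda>x. x \<in> B)"
    using assms unfolding clopens_def by blast
  then show ?thesis
    by (intro that[of "max i j"]; elim invariant_mono) auto
qed

lemma algebra_clopens: "Sigma_Algebra.algebra UNIV clopens"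
  unfolding algebra_iff_Un
proof (intro conjI ballI)
  show "clopens \<subseteq> Pow UNIV" by simp
  show "{} \<in> clopens" by (simp add: clopens_def invariant_def)
  fix A B assume "A \<in> clopens" "B \<in> clopens"
  then obtain k where "invariant k (\<lambda>x. x \<in> A)" "invariant k (\<lambda>x. x \<in> B)"
    by (rule common_level)
  from invariant_comp2[OF this, of "(\<or>)"] show "A \<union> B \<in> clopens"
    by (auto simp: clopens_def)
next
  fix A assume "A \<in> clopens"
  then show "UNIV - A \<in> clopens"
    by (auto simp: clopens_def dest: invariant_comp[where F = Not])
qed

text \<open>An open set is the union of the cosets it contains, and over all levels there are only
  countably many cosets.\<close>

lemma sigma_sets_clopens: "sigma_sets UNIV clopens = sets borel"
proof -
  have "sigma_sets UNIV clopens = sigma_sets UNIV {S. open S}"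
  proof (rule sigma_sets_eqI)
    fix A assume "A \<in> clopens"
    then show "A \<in> sigma_sets UNIV {S. open S}"
      by (auto simp: clopens_def dest: open_invariant)
  next
    fix U :: "'g set" assume "U \<in> {S. open S}"
    then have U: "open U" by simp
    have "U \<subseteq> \<Union> {c \<in> (\<Union>k. range (coset k)). c \<subseteq> U}"
    proof
      fix x assume x: "x \<in> U"
      have "open ((\<lambda>h. x + h) -` U)" using U by (auto intro!: open_vimage continuous_intros)
      from base_N[OF this] x obtain k where k: "N k \<subseteq> (\<lambda>h. x + h) -` U" by auto
      have "coset k x \<subseteq> U"
      proof
        fix y assume "y \<in> coset k x"
        then have "x + (- x + y) \<in> U" using k unfolding coset_def by blast
        then show "y \<in> U" by (simp add: add.assoc[symmetric])
      qed
      then show "x \<in> \<Union> {c \<in> (\<Union>k. range (coset k)). c \<subseteq> U}" using in_coset_self[of x k] by blast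
    qed
    then have "U = \<Union> {c \<in> (\<Union>k. range (coset k)). c \<subseteq> U}" by auto
    moreover have "\<Union> {c \<in> (\<Union>k. range (coset k)). c \<subseteq> U} \<in> sigma_sets UNIV clopens"
    proof (rule sigma_algebra.countable_Union[OF sigma_algebra_sigma_sets])
      have "countable (\<Union>k. range (coset k))"
        by (rule countable_UN) (simp_all add: countable_finite finite_cosets)
      then show "countable {c \<in> (\<Union>k. range (coset k)). c \<subseteq> U}" by (rule countable_subset[rotated]) auto
      show "{c \<in> (\<Union>k. range (coset k)). c \<subseteq> U} \<subseteq> sigma_sets UNIV clopens"
        using invariant_coset by (auto simp: clopens_def intro!: sigma_sets.Basic)
    qed simp
    ultimately show "U \<in> sigma_sets UNIV clopens" by simp
  qed
  then show ?thesis by (simp add: borel_def)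
qed

text \<open>This is \<open>is_haar\<close> without outer regularity, which will turn out to be
  automatic here.\<close>

definition left_invariant_prob :: "'g measure \<Rightarrow> bool" where
  "left_invariant_prob M \<longleftrightarrow>
     sets M = sets borel \<and> prob_space M \<and> (\<forall>x. distr M M ((+) x) = M)"

section \<open>Uniqueness of the invariant probability measure\<close>

lemma measurable_translate [measurable]:
  "(+) z \<in> borel_measurable borel" "(\<lambda>y. y + z) \<in> borel_measurable borel"
  for z :: 'g
  by (intro borel_measurable_continuous_onI continuous_intros)+

text \<open>By invariance all cosets of one level have the same mass, and finitely many of them
  partition the group; so that mass is one over their number.\<close>

lemma emeasure_left_invariant_prob:
  assumes M: "left_invariant_prob M" and A: "invariant k (\<lambda>x. x \<in> A)"
  shows "emeasure M A = ennreal (weight k A)"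
proof -
  interpret prob_space M using M by (simp add: left_invariant_prob_def)
  have sets: "sets M = sets borel" using M by (simp add: left_invariant_prob_def)
  then have space: "space M = UNIV" by (metis sets_eq_imp_space_eq space_borel)
  have cm: "coset k x \<in> sets M" for x by (simp add: sets open_coset)
  have c: "measure M (coset k x) = measure M (coset k 0)" for x
  proof -
    have "measure M (coset k x) = measure (distr M M ((+) x)) (coset k x)"
      using M by (simp add: left_invariant_prob_def)
    also have "\<dots> = measure M ((+) x -` coset k x \<inter> space M)"
      using cm measurable_translate(1)[of x]
      by (intro measure_distr) (auto simp: measurable_cong_sets[OF sets sets])
    also have "(+) x -` coset k x \<inter> space M = coset k 0"
      by (auto simp: coset_def space add.assoc[symmetric])
    finally show ?thesis .
  qed
  have eq: "measure M A = card (cosets_in k A) * measure M (coset k 0)"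
    if A: "invariant k (\<lambda>x. x \<in> A)" for A
  proof -
    have "A = (\<Union>c\<in>cosets_in k A. c)"
    proof (intro equalityI subsetI)
      fix x assume "x \<in> A"
      then have "coset k x \<in> cosets_in k A" using coset_subset_iff[OF A] by (auto simp: cosets_in_def)
      then show "x \<in> (\<Union>c\<in>cosets_in k A. c)" using in_coset_self by blast
    qed (auto simp: cosets_in_def)
    then have "measure M A = measure M (\<Union>c\<in>cosets_in k A. c)" by simp
    also have "\<dots> = (\<Sum>c\<in>cosets_in k A. measure M c)"
    proof (rule finite_measure_finite_Union)
      show "disjoint_family_on (\<lambda>c. c) (cosets_in k A)"
        unfolding disjoint_family_on_def
      proof (intro ballI impI)
        fix c d assume "c \<in> cosets_in k A" "d \<in> cosets_in k A" "c \<noteq> d"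
        then show "c \<inter> d = {}" by (auto simp: cosets_in_def in_coset_iff)
      qed
    next
      show "(\<lambda>c. c) ` cosets_in k A \<subseteq> sets M" unfolding cosets_in_def using cm by blast
    qed (rule finite_cosets_in)
    also have "\<dots> = (\<Sum>c\<in>cosets_in k A. measure M (coset k 0))"
    proof (rule sum.cong[OF refl])
      fix d assume "d \<in> cosets_in k A"
      then obtain x where x: "d = coset k x" unfolding cosets_in_def by blast
      show "measure M d = measure M (coset k 0)" unfolding x by (rule c)
    qed
    finally show ?thesis by simp
  qed
  have "1 = card (range (coset k)) * measure M (coset k 0)"
    using eq[of UNIV] prob_space by (simp add: space cosets_in_UNIV invariant_def)
  then have "measure M (coset k 0) = 1 / card (range (coset k))"
    using card_cosets_pos[of k] by (simp add: field_simps)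
  then show ?thesis
    using eq[OF A] by (simp add: emeasure_eq_measure weight_def)
qed

lemma measure_eqI_clopens:
  assumes "sets M = sets borel" "sets M' = sets borel" "finite_measure M"
    and "\<And>A. A \<in> clopens \<Longrightarrow> emeasure M A = emeasure M' A"
  shows "M = M'"
proof (rule measure_eqI_generator_eq[where E = clopens and \<Omega> = UNIV and A = "\<lambda>_. UNIV"])
  interpret Sigma_Algebra.algebra UNIV clopens by (rule algebra_clopens)
  show "Int_stable clopens" by (auto simp: Int_stable_def)
  show "range (\<lambda>_::nat. UNIV) \<subseteq> clopens" by auto
  show "emeasure M UNIV \<noteq> \<infinity>" using assms(3) by (simp add: finite_measure.emeasure_finite)
qed (use assms in \<open>auto simp: sigma_sets_clopens\<close>)

lemma left_invariant_prob_unique: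
  assumes "left_invariant_prob M" "left_invariant_prob M'"
  shows "M = M'"
proof (rule measure_eqI_clopens)
  fix A assume "A \<in> clopens"
  then show "emeasure M A = emeasure M' A"
    using assms by (auto simp: clopens_def emeasure_left_invariant_prob)
qed (use assms in \<open>auto simp: left_invariant_prob_def prob_space_def\<close>)

section \<open>Existence by Caratheodory extension\<close>

definition premeasure :: "'g set \<Rightarrow> ennreal" where
  "premeasure A = ennreal (weight (LEAST k. invariant k (\<lambda>x. x \<in> A)) A)"

text \<open>By \<open>weight_refine\<close> the level at which \<open>A\<close> is viewed is
  immaterial; the least one merely fixes a value that depends on \<open>A\<close> alone.\<close>

lemma premeasure_eq:
  assumes "invariant k (\<lambda>x. x \<in> A)"
  shows "premeasure A = ennreal (weight k A)"
  unfolding premeasure_def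
  using LeastI[of "\<lambda>k. invariant k (\<lambda>x. x \<in> A)", OF assms] Least_le[of "\<lambda>k. invariant k (\<lambda>x. x \<in> A)", OF assms]
  by (subst weight_refine) auto

text \<open>Compactness supplies countable additivity: the complements form an increasing open
  cover, so one of them is everything, and a content on \<open>clopens\<close> is continuous at the
  empty set.\<close>

lemma decseq_clopens_empty:
  assumes A: "range A \<subseteq> clopens" "decseq A" "(\<Inter>i. A i) = {}"
  shows "\<exists>n. \<forall>i\<ge>n. A i = {}"
proof -
  have op: "open (- A i)" for i
    using A(1) closed_invariant[of _ "A i"] by (auto simp: clopens_def open_Compl)
  obtain F where F: "finite F" "UNIV \<subseteq> (\<Union>i\<in>F. - A i)"
  proof (rule compactE_image[OF compact_UNIV, of UNIV "\<lambda>i. - A i"])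
    show "UNIV \<subseteq> (\<Union>i. - A i)" using A(3) by blast
  qed (auto simp: op)
  have "A i = {}" if "i \<ge> Max (insert 0 F)" for i
  proof -
    have "A i \<subseteq> A j" if "j \<in> F" for j
      using decseqD[OF A(2), of j i] F(1) \<open>i \<ge> _\<close> that by simp
    then show ?thesis using F(2) by fast
  qed
  then show ?thesis by blast
qed

lemma ex_measure_premeasure:
  "\<exists>M. sets M = sets borel \<and> (\<forall>A\<in>clopens. emeasure M A = premeasure A)"
proof -
  interpret Sigma_Algebra.algebra UNIV clopens by (rule algebra_clopens)
  have "\<exists>\<mu>. (\<forall>A\<in>clopens. \<mu> A = premeasure A) \<and> measure_space UNIV (sigma_sets UNIV clopens) \<mu>"
  proof (rule caratheodory_empty_continuous)
    show "positive clopens premeasure"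
      using premeasure_eq[of 0 "{}"] by (simp add: positive_def weight_empty invariant_def)
    show "additive clopens premeasure"
      unfolding additive_def
    proof (intro ballI impI)
      fix A B assume AB: "A \<in> clopens" "B \<in> clopens" and d: "A \<inter> B = {}"
      obtain k where k: "invariant k (\<lambda>x. x \<in> A)" "invariant k (\<lambda>x. x \<in> B)"
        by (rule common_level[OF AB])
      moreover have "invariant k (\<lambda>x. x \<in> A \<union> B)"
        using invariant_comp2[OF k, of "(\<or>)"] by simp
      ultimately show "premeasure (A \<union> B) = premeasure A + premeasure B"
        by (simp add: premeasure_eq weight_Un[OF k d] weight_nonneg)
    qed
    fix A assume "A \<in> clopens"
    then show "premeasure A \<noteq> \<infinity>" by (simp add: premeasure_def)
  next
    fix A :: "nat \<Rightarrow> 'g set" assume "range A \<subseteq> clopens" "decseq A" "(\<Inter>i. A i) = {}"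
    from decseq_clopens_empty[OF this] obtain n where n: "\<And>i. i \<ge> n \<Longrightarrow> A i = {}" by auto
    have "\<forall>\<^sub>F i in sequentially. premeasure (A i) = 0"
      using eventually_ge_at_top[of n]
      by eventually_elim (simp add: n premeasure_def weight_empty)
    then show "(\<lambda>i. premeasure (A i)) \<longlonglongrightarrow> 0"
      by (rule tendsto_eventually)
  qed
  then obtain \<mu> where \<mu>: "\<forall>A\<in>clopens. \<mu> A = premeasure A"
      "measure_space UNIV (sigma_sets UNIV clopens) \<mu>" by auto
  let ?M = "measure_of UNIV clopens \<mu>"
  have "emeasure ?M A = premeasure A" if "A \<in> clopens" for A
  proof -
    have "emeasure ?M A = \<mu> A"
      using \<mu>(2) that by (intro emeasure_measure_of[of ?M UNIV clopens])
        (auto simp: measure_space_def positive_def countably_additive_def)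
    then show ?thesis using \<mu>(1) that by simp
  qed
  moreover have "sets ?M = sets borel" by (simp add: sigma_sets_clopens)
  ultimately show ?thesis by blast
qed

text \<open>Approximating a set and its complement by open sets simultaneously is a condition
  symmetric under complements, so it can be carried through the generation of the Borel sets from
  \<open>clopens\<close>, whose members are open together with their complements.\<close>

lemma finite_measure_outer_regular:
  fixes M :: "'g measure"
  assumes "finite_measure M" and sets: "sets M = sets borel" and A: "A \<in> sets M"
  shows "emeasure M A = (INF U\<in>{U. open U \<and> A \<subseteq> U}. emeasure M U)"
proof -
  interpret finite_measure M by fact
  have openM: "open U \<Longrightarrow> U \<in> sets M" for U by (simp add: sets)
  have "A \<in> sigma_sets UNIV clopens" using A by (simp add: sets sigma_sets_clopens)
  \<comment> \<open>Since \<open>V\<close> covers the complement of \<open>A\<close>, the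
    intersection \<open>U \<inter> V\<close> contains the excess of \<open>U\<close> over
    \<open>A\<close>.\<close>
  then have sandwich: "\<forall>\<epsilon>>0. \<exists>U V. open U \<and> open V \<and> A \<subseteq> U \<and> - A \<subseteq> V \<and> measure M (U \<inter> V) < \<epsilon>"
  proof induction
    case (Basic A)
    then have "open A" "open (- A)"
      using open_invariant closed_invariant by (auto simp: clopens_def)
    then show ?case by - (intro allI impI, rule exI[of _ A], rule exI[of _ "- A"], simp)
  next
    case Empty
    show ?case by (intro allI impI, rule exI[of _ "{}"], rule exI[of _ UNIV]) simp
  next
    case (Compl A)
    show ?case
    proof (intro allI impI)
      fix \<epsilon> :: real assume "\<epsilon> > 0"
      from Compl.IH[rule_format, OF this]
      obtain U V where "open U \<and> open V \<and> A \<subseteq> U \<and> - A \<subseteq> V \<and> measure M (U \<inter> V) < \<epsilon>"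
        by (elim exE)
      then show "\<exists>U V. open U \<and> open V \<and> UNIV - A \<subseteq> U \<and> - (UNIV - A) \<subseteq> V \<and> measure M (U \<inter> V) < \<epsilon>"
        by - (rule exI[of _ V], rule exI[of _ U], simp add: Int_commute Diff_eq)
    qed
  next
    case (Union A)
    show ?case
    proof (intro allI impI)
      fix \<epsilon> :: real assume \<epsilon>: "\<epsilon> > 0"
      \<comment> \<open>These tolerances add up to at most half of \<open>\<epsilon>\<close>; the
        other half pays for truncating the union.\<close>
      have "\<forall>i. \<exists>U V. open U \<and> open V \<and> A i \<subseteq> U \<and> - A i \<subseteq> V \<and> measure M (U \<inter> V) < \<epsilon> / 2 * (1/2) ^ Suc i"
        using \<epsilon> by (intro allI Union.IH[rule_format]) simp
      then obtain U V where UV: "\<And>i. open (U i)" "\<And>i. open (V i)" "\<And>i. A i \<subseteq> U i" "\<And>i. - A i \<subseteq> V i"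
        and small: "\<And>i. measure M (U i \<inter> V i) < \<epsilon> / 2 * (1/2) ^ Suc i"
        by metis
      \<comment> \<open>An infinite intersection of the \<open>V i\<close> need not be open, so only
        the first \<open>n\<close> of them are used; continuity from below bounds the loss.\<close>
      have "(\<lambda>n. measure M (\<Union>i<n. U i)) \<longlonglongrightarrow> measure M (\<Union>n. \<Union>i<n. U i)"
      proof (rule finite_Lim_measure_incseq)
        show "range (\<lambda>n. \<Union>i<n. U i) \<subseteq> sets M" using UV by (auto intro!: openM)
        show "incseq (\<lambda>n. \<Union>i<n. U i)" by (intro monoI UN_mono) auto
      qed
      moreover have "(\<Union>n. \<Union>i<n. U i) = (\<Union>i. U i)" by auto
      ultimately have "\<forall>\<^sub>F n in sequentially. measure M (\<Union>i<n. U i) > measure M (\<Union>i. U i) - \<epsilon> / 2"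
        using \<epsilon> by (intro order_tendstoD) auto
      then obtain n where n: "measure M (\<Union>i<n. U i) > measure M (\<Union>i. U i) - \<epsilon> / 2"
        by (auto simp: eventually_sequentially)
      let ?U = "\<Union>i. U i" and ?V = "\<Inter>i<n. V i"
      have m: "?U \<in> sets M" "(\<Union>i<n. U i) \<in> sets M" "(\<Union>i<n. U i \<inter> V i) \<in> sets M"
        "\<And>i. U i \<inter> V i \<in> sets M"
        using UV by (auto intro!: openM)
      have "?U \<inter> ?V \<subseteq> (?U - (\<Union>i<n. U i)) \<union> (\<Union>i<n. U i \<inter> V i)" by auto
      then have "measure M (?U \<inter> ?V) \<le> measure M ((?U - (\<Union>i<n. U i)) \<union> (\<Union>i<n. U i \<inter> V i))"
        by (rule finite_measure_mono) (intro sets.Un sets.Diff m)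
      also have "\<dots> \<le> measure M (?U - (\<Union>i<n. U i)) + measure M (\<Union>i<n. U i \<inter> V i)"
        by (rule measure_Un_le) (intro sets.Diff m)+
      also have "measure M (?U - (\<Union>i<n. U i)) = measure M ?U - measure M (\<Union>i<n. U i)"
        by (rule finite_measure_Diff[OF m(1,2)]) blast
      also have "measure M (\<Union>i<n. U i \<inter> V i) \<le> (\<Sum>i<n. measure M (U i \<inter> V i))"
        by (rule finite_measure_subadditive_finite) (auto simp: m(4))
      also have "\<dots> \<le> (\<Sum>i<n. \<epsilon> / 2 * (1/2) ^ Suc i)"
        by (intro sum_mono less_imp_le small)
      also have "\<dots> = \<epsilon> / 2 * (\<Sum>i<n. (1/2) ^ Suc i)" by (simp only: sum_distrib_left)
      also have "\<dots> \<le> \<epsilon> / 2 * 1"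
      proof (rule mult_left_mono)
        show "(\<Sum>i<n. (1/2::real) ^ Suc i) \<le> 1"
          using sum_le_suminf[of "\<lambda>i. (1/2::real) ^ Suc i" "{..<n}"] power_half_series
          by (simp add: sums_iff)
      qed (use \<epsilon> in simp)
      finally have "measure M (?U \<inter> ?V) < \<epsilon>" using n by simp
      moreover have "open ?U" "open ?V" using UV by auto
      moreover have "(\<Union>i. A i) \<subseteq> ?U" "- (\<Union>i. A i) \<subseteq> ?V" using UV(3,4) by blast+
      ultimately show "\<exists>U V. open U \<and> open V \<and> (\<Union>i. A i) \<subseteq> U \<and> - (\<Union>i. A i) \<subseteq> V \<and> measure M (U \<inter> V) < \<epsilon>"
        by blast
    qed
  qed
  show ?thesis
  proof (rule antisym)
    show "emeasure M A \<le> (INF U\<in>{U. open U \<and> A \<subseteq> U}. emeasure M U)"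
      by (intro INF_greatest emeasure_mono) (auto intro: openM)
    show "(INF U\<in>{U. open U \<and> A \<subseteq> U}. emeasure M U) \<le> emeasure M A"
    proof (rule ennreal_le_epsilon)
      fix \<epsilon> :: real assume "\<epsilon> > 0"
      from sandwich[rule_format, OF this]
      obtain U V where UV: "open U" "open V" "A \<subseteq> U" "- A \<subseteq> V" "measure M (U \<inter> V) < \<epsilon>"
        by (elim exE conjE)
      have "measure M U \<le> measure M (A \<union> (U \<inter> V))"
        using UV A by (intro finite_measure_mono) (auto intro!: openM sets.Un[OF A])
      also have "\<dots> \<le> measure M A + measure M (U \<inter> V)"
        using UV A by (intro measure_Un_le) (auto intro!: openM)
      finally have "measure M U \<le> measure M A + \<epsilon>" using UV by simp
      then have "emeasure M U \<le> emeasure M A + ennreal \<epsilon>"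
        using \<open>\<epsilon> > 0\<close> by (simp add: emeasure_eq_measure flip: ennreal_plus)
      moreover have "(INF U\<in>{U. open U \<and> A \<subseteq> U}. emeasure M U) \<le> emeasure M U"
        using UV by (intro INF_lower) auto
      ultimately show "(INF U\<in>{U. open U \<and> A \<subseteq> U}. emeasure M U) \<le> emeasure M A + ennreal \<epsilon>" by order
    qed
  qed
qed

section \<open>The Haar measure and its two-sided invariance\<close>

lemma is_haar_iff: "is_haar M \<longleftrightarrow> left_invariant_prob (M :: 'g measure)"
  unfolding is_haar_def left_invariant_prob_def
  using finite_measure_outer_regular prob_space_def by blast

text \<open>Translation permutes the cosets of each level, so the translated measure agrees with the
  original one on \<open>clopens\<close>, and hence everywhere.\<close>

lemma ex_left_invariant_prob: "\<exists>M. left_invariant_prob M"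
proof -
  obtain M where sets: "sets M = sets borel" and M: "\<And>A. A \<in> clopens \<Longrightarrow> emeasure M A = premeasure A"
    using ex_measure_premeasure by auto
  have space: "space M = UNIV" using sets by (metis sets_eq_imp_space_eq space_borel)
  have M': "emeasure M A = ennreal (weight k A)" if "invariant k (\<lambda>x. x \<in> A)" for k A
    using M[of A] premeasure_eq[OF that] that by (auto simp: clopens_def)
  have prob: "prob_space M"
    by (rule prob_spaceI) (use M'[of 0 UNIV] in \<open>simp add: space weight_UNIV invariant_def\<close>)
  have "distr M M ((+) z) = M" for z
  proof (rule measure_eqI_clopens)
    have m: "(+) z \<in> measurable M M"
      using measurable_translate(1)[of z] by (simp add: measurable_cong_sets[OF sets sets])
    show "finite_measure (distr M M ((+) z))"
      using prob_space.prob_space_distr[OF prob m] by (simp add: prob_space_def)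
    fix A assume A: "A \<in> clopens"
    then obtain k where k: "invariant k (\<lambda>x. x \<in> A)" by (auto simp: clopens_def)
    have Am: "A \<in> sets M" using open_invariant[OF k] by (simp add: sets)
    have pre: "(+) z -` A = (+) (- z) ` A"
    proof (intro equalityI subsetI)
      fix x assume "x \<in> (+) z -` A"
      then show "x \<in> (+) (- z) ` A" by (intro image_eqI[of _ _ "z + x"]) (auto simp: add.assoc[symmetric])
    qed (auto simp: add.assoc[symmetric])
    have "emeasure (distr M M ((+) z)) A = emeasure M ((+) z -` A)"
      using emeasure_distr[OF m Am] by (simp add: space)
    also have "\<dots> = ennreal (weight k ((+) z -` A))"
      using invariant_translate_left[OF k, of z] by (intro M') simp
    also have "\<dots> = ennreal (weight k A)"
      unfolding pre weight_def card_cosets_in_translate ..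
    also have "\<dots> = emeasure M A" by (rule M'[OF k, symmetric])
    finally show "emeasure (distr M M ((+) z)) A = emeasure M A" .
  qed (simp_all add: sets)
  then show ?thesis using sets prob by (auto simp: left_invariant_prob_def)
qed

lemma left_invariant_prob_haar: "left_invariant_prob (haar :: 'g measure)"
proof -
  have "\<exists>!M :: 'g measure. is_haar M"
    unfolding is_haar_iff using ex_left_invariant_prob left_invariant_prob_unique by blast
  then have "is_haar (haar :: 'g measure)" unfolding haar_def by (rule theI')
  then show ?thesis by (simp add: is_haar_iff)
qed

lemma sets_haar [simp]: "sets (haar :: 'g measure) = sets borel"
  and prob_space_haar: "prob_space (haar :: 'g measure)"
  using left_invariant_prob_haar by (auto simp: left_invariant_prob_def)

lemma space_haar [simp]: "space (haar :: 'g measure) = UNIV"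
  using sets_haar by (metis sets_eq_imp_space_eq space_borel)

text \<open>Left and right translations commute, so the right translate of \<open>haar\<close> is
  again a left-invariant probability, and uniqueness applies.\<close>

lemma haar_right_invariant: "distr haar haar (\<lambda>y. y + z) = (haar :: 'g measure)"
proof (rule left_invariant_prob_unique[OF _ left_invariant_prob_haar])
  have m: "(+) x \<in> measurable haar haar" "(\<lambda>y. y + z) \<in> measurable haar haar" for x z :: 'g
    using measurable_translate by (simp_all add: measurable_cong_sets[OF sets_haar sets_haar])
  have "distr (distr haar haar (\<lambda>y. y + z)) (distr haar haar (\<lambda>y. y + z)) ((+) x)
      = distr haar haar (\<lambda>y. y + z)" for x :: 'g
  proof -
    have "distr (distr haar haar (\<lambda>y. y + z)) (distr haar haar (\<lambda>y. y + z)) ((+) x)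
        = distr (distr haar haar (\<lambda>y. y + z)) haar ((+) x)"
      by (rule distr_cong) auto
    also have "\<dots> = distr (distr haar haar ((+) x)) haar (\<lambda>y. y + z)"
      by (subst (1 2) distr_distr) (auto simp: m comp_def add.assoc)
    also have "distr haar haar ((+) x) = haar"
      using left_invariant_prob_haar by (simp add: left_invariant_prob_def)
    finally show ?thesis .
  qed
  then show "left_invariant_prob (distr haar haar (\<lambda>y. y + z))"
    unfolding left_invariant_prob_def
    using prob_space.prob_space_distr[OF prob_space_haar m(2)] by simp
qed

end


section \<open>Locally constant functions\<close>

lemma abs_l2_0: "abs_l2 (\<lambda>_. 0) = 0"
  by (rule zero_l2.abs_eq[symmetric])

lemma l2_cases:
  obtains f where "sq_integrable haar f" "u = abs_l2 f"
  using sq_integrable_rep_l2 abs_rep_l2 by metis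

lemma abs_l2_sum:
  assumes "\<And>i. i \<in> I \<Longrightarrow> sq_integrable haar (f i)"
  shows "sq_integrable haar (\<lambda>x. \<Sum>i\<in>I. f i x)"
    and "abs_l2 (\<lambda>x. \<Sum>i\<in>I. f i x) = (\<Sum>i\<in>I. abs_l2 (f i))"
  using assms
  by (induction I rule: infinite_finite_induct)
     (simp_all add: sq_integrable_0 abs_l2_0 sq_integrable_add flip: abs_l2_add)

lemma csubspace_closure:
  assumes "csubspace S" shows "csubspace (closure S)"
  unfolding csubspace_def
proof (intro conjI ballI allI)
  show "0 \<in> closure S" using assms closure_subset by (auto simp: csubspace_def)
  fix u v c assume "u \<in> closure S" "v \<in> closure S"
  then obtain f g where f: "\<And>n::nat. f n \<in> S" "f \<longlonglongrightarrow> u" and g: "\<And>n::nat. g n \<in> S" "g \<longlonglongrightarrow> v"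
    unfolding closure_sequential by blast
  have "(\<lambda>n. f n + g n) \<longlonglongrightarrow> u + v" using f g by (intro tendsto_add)
  moreover have "f n + g n \<in> S" for n using assms f g by (auto simp: csubspace_def)
  ultimately show "u + v \<in> closure S"
    unfolding closure_sequential by (intro exI[of _ "\<lambda>n. f n + g n"]) simp
next
  fix u c assume "u \<in> closure S"
  then obtain f where f: "\<And>n::nat. f n \<in> S" "f \<longlonglongrightarrow> u"
    unfolding closure_sequential by blast
  have "(\<lambda>n. scaleC c (f n)) \<longlonglongrightarrow> scaleC c u"
    using f by (intro bounded_bilinear.tendsto[OF bounded_bilinear_scaleC] tendsto_const)
  moreover have "scaleC c (f n) \<in> S" for n using assms f by (auto simp: csubspace_def)
  ultimately show "scaleC c u \<in> closure S"
    unfolding closure_sequential by (intro exI[of _ "\<lambda>n. scaleC c (f n)"]) simp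
qed

section \<open>Multiplication operators\<close>

lemma sq_integrable_mult_bounded:
  assumes f: "f \<in> borel_measurable M" "\<And>x. cmod (f x) \<le> B" and g: "sq_integrable M g"
  shows "sq_integrable M (\<lambda>x. f x * g x)"
    and "(\<integral>x. (cmod (f x * g x))\<^sup>2 \<partial>M) \<le> B\<^sup>2 * (\<integral>x. (cmod (g x))\<^sup>2 \<partial>M)"
proof -
  have [measurable]: "f \<in> borel_measurable M" "g \<in> borel_measurable M"
    using f g by (auto simp: sq_integrable_def)
  have i: "integrable M (\<lambda>x. B\<^sup>2 * (cmod (g x))\<^sup>2)"
    using g by (simp add: sq_integrable_def)
  have le: "(cmod (f x * g x))\<^sup>2 \<le> B\<^sup>2 * (cmod (g x))\<^sup>2" for x
    using f(2)[of x] by (auto simp: norm_mult power_mult_distrib intro!: mult_right_mono power_mono)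
  have "integrable M (\<lambda>x. (cmod (f x * g x))\<^sup>2)"
    by (rule Bochner_Integration.integrable_bound[OF i]) (use le in auto)
  then show "sq_integrable M (\<lambda>x. f x * g x)" by (simp add: sq_integrable_def)
  then have "(\<integral>x. (cmod (f x * g x))\<^sup>2 \<partial>M) \<le> (\<integral>x. B\<^sup>2 * (cmod (g x))\<^sup>2 \<partial>M)"
    by (intro integral_mono i le) (simp add: sq_integrable_def)
  then show "(\<integral>x. (cmod (f x * g x))\<^sup>2 \<partial>M) \<le> B\<^sup>2 * (\<integral>x. (cmod (g x))\<^sup>2 \<partial>M)" by simp
qed

lemma mult_op_abs_l2:
  assumes "f \<in> borel_measurable haar" "\<And>x. cmod (f x) \<le> B" "sq_integrable haar g"
  shows "mult_op f (abs_l2 g) = abs_l2 (\<lambda>x. f x * g x)"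
  unfolding mult_op_def
  using rep_abs_l2_AE[OF assms(3)]
  by (intro abs_l2_eqI sq_integrable_mult_bounded[OF assms(1,2)] sq_integrable_rep_l2 assms(3))
     (auto elim: eventually_mono)

lemma bounded_op_mult_op:
  assumes f: "f \<in> borel_measurable haar" "\<And>x. cmod (f x) \<le> B"
  shows "bounded_op (mult_op f)"
proof (rule bounded_opI)
  note sq = sq_integrable_mult_bounded[OF f]
  note mo = mult_op_abs_l2[OF f]
  fix u v :: "'a l2" and c
  obtain g where g: "sq_integrable haar g" "u = abs_l2 g" by (rule l2_cases)
  obtain h where h: "sq_integrable haar h" "v = abs_l2 h" by (rule l2_cases)
  show "mult_op f (u + v) = mult_op f u + mult_op f v"
    using g h by (simp add: abs_l2_add mo sq sq_integrable_add distrib_left)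
  show "mult_op f (scaleC c u) = scaleC c (mult_op f u)"
    using g by (simp add: abs_l2_scaleC mo sq sq_integrable_cmult mult.left_commute)
  have "(norm (mult_op f u))\<^sup>2 \<le> B\<^sup>2 * (norm u)\<^sup>2"
    using sq(2)[OF g(1)] by (simp add: g mo norm_abs_l2 sq)
  moreover have "B \<ge> 0" using f(2)[of 0] norm_ge_zero order_trans by blast
  ultimately show "norm (mult_op f u) \<le> norm u * B"
    by (simp add: power_mult_distrib[symmetric] mult.commute power2_le_iff_abs_le)
qed

lemma cinner_mult_op:
  assumes f: "f \<in> borel_measurable haar" "\<And>x. cmod (f x) \<le> B"
  shows "cinner (mult_op f u) v = cinner u (mult_op (\<lambda>x. cnj (f x)) v)"
proof -
  have f': "(\<lambda>x. cnj (f x)) \<in> borel_measurable haar" "\<And>x. cmod (cnj (f x)) \<le> B"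
    using f by (auto intro: measurable_cnj)
  obtain g where g: "sq_integrable haar g" "u = abs_l2 g" by (rule l2_cases)
  obtain h where h: "sq_integrable haar h" "v = abs_l2 h" by (rule l2_cases)
  show ?thesis
    unfolding g(2) h(2) mult_op_abs_l2[OF f g(1)] mult_op_abs_l2[OF f' h(1)]
      cinner_abs_l2[OF sq_integrable_mult_bounded(1)[OF f g(1)] h(1)]
      cinner_abs_l2[OF g(1) sq_integrable_mult_bounded(1)[OF f' h(1)]]
    by (simp add: mult_ac)
qed

context subgroup_filtration
begin

section \<open>Right translations on L^2(G)\<close>

lemma measurable_haar_translate [measurable]: "(\<lambda>y. y + z) \<in> measurable haar (haar :: 'g measure)"
  using measurable_translate(2) by (simp add: measurable_cong_sets[OF sets_haar sets_haar])

lemma integral_translate: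
  fixes f :: "'g \<Rightarrow> 'b::{banach, second_countable_topology}"
  assumes "f \<in> borel_measurable haar"
  shows "(\<integral>y. f (y + z) \<partial>haar) = (\<integral>y. f y \<partial>haar)"
  using integral_distr[OF measurable_haar_translate assms, of z] by (simp add: haar_right_invariant)

lemma sq_integrable_translate:
  fixes f :: "'g \<Rightarrow> complex"
  assumes "sq_integrable haar f"
  shows "sq_integrable haar (\<lambda>y. f (y + z))"
proof -
  have f: "f \<in> borel_measurable haar" "integrable haar (\<lambda>x. (cmod (f x))\<^sup>2)"
    using assms by (auto simp: sq_integrable_def)
  have "integrable (distr haar haar (\<lambda>y. y + z)) (\<lambda>x. (cmod (f x))\<^sup>2)"
    using f(2) by (simp only: haar_right_invariant)
  then have "integrable haar (\<lambda>y. (cmod (f (y + z)))\<^sup>2)"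
    by (rule integrable_distr[OF measurable_haar_translate])
  moreover have "(\<lambda>y. f (y + z)) \<in> borel_measurable haar"
    using measurable_compose[OF measurable_haar_translate f(1)] .
  ultimately show ?thesis by (simp add: sq_integrable_def)
qed

lemma AE_translate:
  assumes "AE y in haar. P (y :: 'g)"
  shows "AE y in haar. P (y + z)"
proof -
  have "AE y in distr haar haar (\<lambda>y. y + z). P y" using assms by (simp only: haar_right_invariant)
  then show ?thesis by (rule AE_distrD[OF measurable_haar_translate])
qed

lemma right_reg_abs_l2:
  assumes "sq_integrable haar (f :: 'g \<Rightarrow> complex)"
  shows "right_reg z (abs_l2 f) = abs_l2 (\<lambda>y. f (y + z))"
  unfolding right_reg_def
  using AE_translate[OF rep_abs_l2_AE[OF assms]]
  by (intro abs_l2_eqI sq_integrable_translate sq_integrable_rep_l2 assms)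

lemma bounded_op_right_reg: "bounded_op (right_reg (z :: 'g))"
proof (rule bounded_opI)
  fix u v :: "'g l2" and c
  obtain g where g: "sq_integrable haar g" "u = abs_l2 g" by (rule l2_cases)
  obtain h where h: "sq_integrable haar h" "v = abs_l2 h" by (rule l2_cases)
  show "right_reg z (u + v) = right_reg z u + right_reg z v"
    using g h by (simp add: abs_l2_add right_reg_abs_l2 sq_integrable_translate sq_integrable_add)
  show "right_reg z (scaleC c u) = scaleC c (right_reg z u)"
    using g by (simp add: abs_l2_scaleC right_reg_abs_l2 sq_integrable_translate sq_integrable_cmult)
  have "(\<lambda>x. (cmod (g x))\<^sup>2) \<in> borel_measurable haar"
    using g(1) by (simp add: sq_integrable_def borel_measurable_integrable)
  from integral_translate[OF this, of z] have "(norm (right_reg z u))\<^sup>2 = (norm u)\<^sup>2"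
    using g by (simp add: right_reg_abs_l2 norm_abs_l2 sq_integrable_translate)
  then show "norm (right_reg z u) \<le> norm u * 1" by simp
qed

lemma cinner_right_reg: "cinner (right_reg z u) v = cinner u (right_reg (- z :: 'g) v)"
proof -
  obtain g where g: "sq_integrable haar g" "u = abs_l2 g" by (rule l2_cases)
  obtain h where h: "sq_integrable haar h" "v = abs_l2 h" by (rule l2_cases)
  have "(\<integral>y. cnj (g (y + z)) * h (y + z + - z) \<partial>haar) = (\<integral>y. cnj (g y) * h (y + - z) \<partial>haar)"
    using g(1) sq_integrable_translate[OF h(1), of "- z"]
    by (intro integral_translate[of "\<lambda>y. cnj (g y) * h (y + - z)" z] borel_measurable_times measurable_cnj)
       (auto simp: sq_integrable_def)
  then show ?thesis
    using g h by (simp add: right_reg_abs_l2 cinner_abs_l2 sq_integrable_translate add.assoc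
        del: add_uminus_conv_diff)
qed

section \<open>The layers of invariant functions\<close>

lemma invariant_bounded:
  assumes "invariant k (f :: 'g \<Rightarrow> complex)"
  obtains B where "\<And>x. cmod (f x) \<le> B"
proof -
  have "compact (range f)"
    by (rule compact_continuous_image[OF continuous_on_invariant[OF assms] compact_UNIV])
  then show ?thesis
    using that compact_imp_bounded[THEN bounded_iff[THEN iffD1]] by (metis rangeI)
qed

lemma invariant_measurable:
  "invariant k (f :: 'g \<Rightarrow> 'b::topological_space) \<Longrightarrow> f \<in> borel_measurable haar"
  using borel_measurable_continuous_onI[OF continuous_on_invariant]
  by (simp add: measurable_cong_sets[OF sets_haar refl])

lemma sq_integrable_const: "sq_integrable haar (\<lambda>_::'g. c)"
  using prob_space_haar by (simp add: sq_integrable_def prob_space_def finite_measure.integrable_const)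

lemma sq_integrable_invariant:
  assumes "invariant k (f :: 'g \<Rightarrow> complex)"
  shows "sq_integrable haar f"
proof -
  obtain B where "\<And>x. cmod (f x) \<le> B" using invariant_bounded[OF assms] by blast
  from sq_integrable_mult_bounded(1)[OF invariant_measurable[OF assms] this sq_integrable_const[of 1]]
  show ?thesis by simp
qed

definition layer :: "nat \<Rightarrow> 'g l2 set" where
  "layer k = {abs_l2 f | f. invariant k f}"

lemma layerI: "invariant k f \<Longrightarrow> abs_l2 f \<in> layer k"
  by (auto simp: layer_def)

lemma layer_mono: "k \<le> l \<Longrightarrow> layer k \<subseteq> layer l"
  using invariant_mono by (auto simp: layer_def)

lemma csubspace_layer: "csubspace (layer k)"
  unfolding csubspace_def
proof (intro conjI ballI allI)
  show "0 \<in> layer k" using layerI[of k "\<lambda>_. 0"] by (simp add: abs_l2_0 invariant_def)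
  fix u v assume "u \<in> layer k" "v \<in> layer k"
  then obtain f g where f: "invariant k f" "u = abs_l2 f" and g: "invariant k g" "v = abs_l2 g"
    by (auto simp: layer_def)
  from layerI[OF invariant_comp2[OF f(1) g(1), of "(+)"]] show "u + v \<in> layer k"
    using f g by (simp add: abs_l2_add sq_integrable_invariant)
next
  fix c u assume "u \<in> layer k"
  then obtain f where f: "invariant k f" "u = abs_l2 f" by (auto simp: layer_def)
  from layerI[OF invariant_comp[OF f(1), of "\<lambda>y. c * y"]] show "scaleC c u \<in> layer k"
    using f by (simp add: abs_l2_scaleC sq_integrable_invariant[of k f])
qed

lemma mult_op_layer:
  assumes f: "invariant k f" and u: "u \<in> layer k"
  shows "mult_op f u \<in> layer k"
proof -
  obtain B where B: "\<And>x. cmod (f x) \<le> B" using invariant_bounded[OF f] by blast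
  obtain g where g: "invariant k g" "u = abs_l2 g" using u by (auto simp: layer_def)
  have "mult_op f u = abs_l2 (\<lambda>x. f x * g x)"
    unfolding g by (rule mult_op_abs_l2[OF invariant_measurable[OF f] B sq_integrable_invariant[OF g(1)]])
  then show ?thesis using layerI[OF invariant_comp2[OF f g(1), of "times"]] by simp
qed

lemma right_reg_layer:
  assumes u: "u \<in> layer k"
  shows "right_reg z u \<in> layer k"
proof -
  obtain g where g: "invariant k g" "u = abs_l2 g" using u by (auto simp: layer_def)
  then show ?thesis
    using layerI[OF invariant_translate_right[OF g(1)]] by (simp add: right_reg_abs_l2 sq_integrable_invariant)
qed

section \<open>Coset indicators and density of the layers\<close>

definition ind :: "'g set \<Rightarrow> 'g l2" where
  "ind A = abs_l2 (\<lambda>x. of_bool (x \<in> A))"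

lemma sq_integrable_of_bool:
  assumes "A \<in> sets borel"
  shows "sq_integrable haar (\<lambda>x::'g. of_bool (x \<in> A))"
proof -
  have *: "(\<lambda>x::'g. of_bool (x \<in> A) :: complex) = indicator A" by (auto simp: indicator_def)
  have "(\<lambda>x::'g. of_bool (x \<in> A) :: complex) \<in> borel_measurable haar"
    unfolding * using assms by (intro borel_measurable_indicator) simp
  from sq_integrable_mult_bounded(1)[OF this, of 1, OF _ sq_integrable_const[of 1]]
  show ?thesis by simp
qed

lemma ind_coset_in_layer: "ind (coset k x) \<in> layer k"
  unfolding ind_def using invariant_comp[OF invariant_coset] by (intro layerI)

text \<open>An invariant function is constant on each of the finitely many cosets.\<close>

lemma layer_subset_hull: "layer k \<subseteq> csubspace hull (ind ` range (coset k))"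
proof
  fix u assume "u \<in> layer k"
  then obtain f where f: "invariant k f" "u = abs_l2 f" by (auto simp: layer_def)
  let ?H = "csubspace hull (ind ` range (coset k))"
  \<comment> \<open>A representative of each coset; the choice is harmless because \<open>f\<close>
    is constant there.\<close>
  define r where "r c = (SOME x. coset k x = c)" for c
  have r: "coset k (r (coset k x)) = coset k x" for x
    unfolding r_def by (rule someI) (rule refl)
  have "f x = (\<Sum>c\<in>range (coset k). f (r c) * of_bool (x \<in> c))" for x
  proof -
    have "(\<Sum>c\<in>range (coset k). f (r c) * of_bool (x \<in> c))
        = (\<Sum>c\<in>range (coset k). if c = coset k x then f x else 0)"
    proof (rule sum.cong[OF refl])
      fix c assume "c \<in> range (coset k)"
      then obtain y where y: "c = coset k y" by blast
      have "f (r c) = f y" using f(1) r[of y] unfolding invariant_iff_coset y by blast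
      moreover have "x \<in> c \<longleftrightarrow> c = coset k x" unfolding y in_coset_iff by auto
      moreover have "f y = f x" if "c = coset k x"
        using f(1) that unfolding invariant_iff_coset y by blast
      ultimately show "f (r c) * of_bool (x \<in> c) = (if c = coset k x then f x else 0)" by auto
    qed
    also have "\<dots> = f x" using finite_cosets[of k] by simp
    finally show ?thesis ..
  qed
  then have "u = abs_l2 (\<lambda>x. \<Sum>c\<in>range (coset k). f (r c) * of_bool (x \<in> c))"
    unfolding f(2) by (intro arg_cong[where f = abs_l2] ext)
  also have "\<dots> = (\<Sum>c\<in>range (coset k). scaleC (f (r c)) (ind c))"
  proof (subst abs_l2_sum(2))
    have b: "sq_integrable haar (\<lambda>x. of_bool (x \<in> c))" if "c \<in> range (coset k)" for c
      using that open_coset by (intro sq_integrable_of_bool) auto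
    show "sq_integrable haar (\<lambda>x. f (r c) * of_bool (x \<in> c))" if "c \<in> range (coset k)" for c
      using b[OF that] by (rule sq_integrable_cmult)
    show "(\<Sum>c\<in>range (coset k). abs_l2 (\<lambda>x. f (r c) * of_bool (x \<in> c)))
        = (\<Sum>c\<in>range (coset k). scaleC (f (r c)) (ind c))"
      unfolding ind_def using b by (intro sum.cong refl) (simp only: abs_l2_scaleC)
  qed
  also have "\<dots> \<in> ?H"
  proof (rule csubspace_sum[OF csubspace_hull])
    fix c assume "c \<in> range (coset k)"
    then have "ind c \<in> ?H" by (intro hull_inc imageI)
    then show "scaleC (f (r c)) (ind c) \<in> ?H" using csubspace_hull unfolding csubspace_def by blast
  qed
  finally show "u \<in> ?H" .
qed

lemma csubspace_UN_layer: "csubspace (\<Union>k. layer k)"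
  unfolding csubspace_def
proof (intro conjI ballI allI)
  show "0 \<in> (\<Union>k. layer k)" using csubspace_layer unfolding csubspace_def by blast
  fix u v assume "u \<in> (\<Union>k. layer k)" "v \<in> (\<Union>k. layer k)"
  then obtain k l where "u \<in> layer k" "v \<in> layer l" by blast
  then have "u \<in> layer (max k l)" "v \<in> layer (max k l)"
    using layer_mono[of k "max k l"] layer_mono[of l "max k l"] by auto
  then have "u + v \<in> layer (max k l)"
    using csubspace_layer[of "max k l"] by (simp add: csubspace_def)
  then show "u + v \<in> (\<Union>k. layer k)" by blast
next
  fix c u assume "u \<in> (\<Union>k. layer k)"
  then obtain k where "u \<in> layer k" by blast
  then have "scaleC c u \<in> layer k" using csubspace_layer[of k] by (simp add: csubspace_def)
  then show "scaleC c u \<in> (\<Union>k. layer k)" by blast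
qed

text \<open>A Dynkin argument: the sets whose indicator lies in the closure include
  \<open>clopens\<close> and are stable under complements and countable disjoint unions.
  Disjointness turns finite unions into sums of indicators.\<close>

lemma ind_in_closure:
  assumes "A \<in> sets (borel :: 'g measure)"
  shows "ind A \<in> closure (\<Union>k. layer k)"
proof -
  let ?W = "closure (\<Union>k. layer k)"
  have W: "csubspace ?W" by (rule csubspace_closure[OF csubspace_UN_layer])
  interpret prob_space "haar :: 'g measure" by (rule prob_space_haar)
  interpret A: Sigma_Algebra.algebra UNIV clopens by (rule algebra_clopens)
  have S: "sigma_sets UNIV clopens = sets borel" by (rule sigma_sets_clopens)
  have base: "ind A \<in> ?W" if "A \<in> clopens" for A
  proof -
    obtain k where k: "invariant k (\<lambda>x. x \<in> A)" using \<open>A \<in> clopens\<close> by (auto simp: clopens_def)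
    have "ind A \<in> layer k" unfolding ind_def by (rule layerI[OF invariant_comp[OF k]])
    then show ?thesis using closure_subset[of "\<Union>k. layer k"] by blast
  qed
  have "Int_stable clopens" by (auto simp: Int_stable_def)
  moreover have "clopens \<subseteq> Pow UNIV" by simp
  moreover have "A \<in> sigma_sets UNIV clopens" using assms S by simp
  ultimately show ?thesis
  proof (induction rule: sigma_sets_induct_disjoint)
    case (basic A)
    then show ?case by (rule base)
  next
    case empty
    show ?case by (rule base) simp
  next
    case (compl A)
    have A: "A \<in> sets borel" using compl.hyps S by simp
    have "ind UNIV - ind A = abs_l2 (\<lambda>x. of_bool (x \<in> UNIV) - of_bool (x \<in> A))"
      unfolding ind_def by (rule abs_l2_diff[OF sq_integrable_of_bool sq_integrable_of_bool[OF A]]) simp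
    also have "\<dots> = ind (UNIV - A)"
      unfolding ind_def by (intro arg_cong[where f = abs_l2] ext) auto
    finally have "ind (UNIV - A) = ind UNIV - ind A" ..
    moreover have "ind UNIV \<in> ?W" by (rule base) simp
    ultimately show ?case using csubspace_minus[OF W] compl.IH by simp
  next
    case (union A)
    have A: "A i \<in> sets borel" for i using union.hyps S by auto
    define B where "B n = (\<Union>i<n. A i)" for n
    have B: "B n \<in> sets borel" "(\<Union>i. A i) \<in> sets borel" for n using A by (auto simp: B_def)
    have "ind (B n) \<in> ?W" for n
    proof (induction n)
      case 0
      show ?case by (rule base) (simp add: B_def)
    next
      case (Suc n)
      have "A n \<inter> A i = {}" if "i < n" for i
        using union.hyps(1) that by (simp add: disjoint_family_on_def)
      then have d: "A n \<inter> B n = {}" by (auto simp: B_def)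
      have "ind (B (Suc n)) = ind (B n) + ind (A n)"
        unfolding ind_def
      proof (subst abs_l2_add)
        show "abs_l2 (\<lambda>x. of_bool (x \<in> B (Suc n))) = abs_l2 (\<lambda>x. of_bool (x \<in> B n) + of_bool (x \<in> A n))"
          using d by (intro arg_cong[where f = abs_l2] ext) (auto simp: B_def lessThan_Suc)
      qed (intro sq_integrable_of_bool A B)+
      then show ?case using Suc union.IH[of n] W by (auto simp: csubspace_def)
    qed
    moreover have "(\<lambda>n. ind (B n)) \<longlonglongrightarrow> ind (\<Union>i. A i)"
    proof (rule LIM_zero_cancel, rule tendsto_norm_zero_cancel)
      \<comment> \<open>The squared distance is the mass of the part of the union not yet reached,
        which tends to 0 by continuity from below.\<close>
      have "(norm (ind (B n) - ind (\<Union>i. A i)))\<^sup>2 = measure haar (\<Union>i. A i) - measure haar (B n)" for n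
      proof -
        have "ind (B n) - ind (\<Union>i. A i) = abs_l2 (\<lambda>x. of_bool (x \<in> B n) - of_bool (x \<in> (\<Union>i. A i)))"
          unfolding ind_def by (intro abs_l2_diff sq_integrable_of_bool B)
        then have "(norm (ind (B n) - ind (\<Union>i. A i)))\<^sup>2
            = (\<integral>x. (cmod (of_bool (x \<in> B n) - of_bool (x \<in> (\<Union>i. A i))))\<^sup>2 \<partial>haar)"
          by (simp only:) (intro norm_abs_l2 sq_integrable_minus sq_integrable_of_bool B)
        also have "\<dots> = (\<integral>x. indicator ((\<Union>i. A i) - B n) x \<partial>haar)"
          by (intro Bochner_Integration.integral_cong) (auto simp: B_def indicator_def)
        also have "\<dots> = measure haar ((\<Union>i. A i) - B n)"
          using B by simp
        also have "\<dots> = measure haar (\<Union>i. A i) - measure haar (B n)"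
          using B(2) B(1)[of n] by (intro finite_measure_Diff) (auto simp: B_def)
        finally show ?thesis .
      qed
      then have n: "norm (ind (B n) - ind (\<Union>i. A i)) = sqrt (measure haar (\<Union>i. A i) - measure haar (B n))" for n
        by (metis norm_ge_zero real_sqrt_abs abs_of_nonneg)
      have "(\<lambda>n. measure haar (B n)) \<longlonglongrightarrow> measure haar (\<Union>n. B n)"
      proof (rule finite_Lim_measure_incseq)
        show "incseq B" unfolding B_def by (intro monoI UN_mono) auto
      qed (use B in auto)
      moreover have "(\<Union>n. B n) = (\<Union>i. A i)" by (auto simp: B_def)
      ultimately have "(\<lambda>n. sqrt (measure haar (\<Union>i. A i) - measure haar (B n)))
          \<longlonglongrightarrow> sqrt (measure haar (\<Union>i. A i) - measure haar (\<Union>i. A i))"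
        by (intro tendsto_intros) simp
      then show "(\<lambda>n. norm (ind (B n) - ind (\<Union>i. A i))) \<longlonglongrightarrow> 0" by (simp add: n)
    qed
    ultimately show ?case by (rule closed_sequentially[OF closed_closure])
  qed
qed

text \<open>Linearity passes from indicators to simple functions, and dominated convergence from
  these to all of L^2.\<close>

lemma closure_UN_layer: "closure (\<Union>k. layer k) = UNIV"
proof -
  let ?W = "closure (\<Union>k. layer k)"
  have W: "csubspace ?W" by (rule csubspace_closure[OF csubspace_UN_layer])
  have simple: "abs_l2 s \<in> ?W" if s: "simple_function haar (s :: 'g \<Rightarrow> complex)" for s
  proof -
    have fin: "finite (range s)" and m: "s -` {y} \<in> sets borel" for y
      using simple_functionD[OF s] by simp_all
    have sq: "sq_integrable haar (\<lambda>x. of_bool (x \<in> s -` {y}))" for y by (rule sq_integrable_of_bool[OF m])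
    have "s = (\<lambda>x. \<Sum>y\<in>range s. y * of_bool (x \<in> s -` {y}))"
    proof
      fix x
      have "(\<Sum>y\<in>range s. y * of_bool (x \<in> s -` {y})) = (\<Sum>y\<in>range s. if y = s x then s x else 0)"
        by (intro sum.cong) auto
      also have "\<dots> = s x" using fin by simp
      finally show "s x = (\<Sum>y\<in>range s. y * of_bool (x \<in> s -` {y}))" ..
    qed
    then have "abs_l2 s = abs_l2 (\<lambda>x. \<Sum>y\<in>range s. y * of_bool (x \<in> s -` {y}))"
      by (rule arg_cong)
    also have "\<dots> = (\<Sum>y\<in>range s. abs_l2 (\<lambda>x. y * of_bool (x \<in> s -` {y})))"
      by (intro abs_l2_sum(2) sq_integrable_cmult sq)
    also have "\<dots> = (\<Sum>y\<in>range s. scaleC y (ind (s -` {y})))"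
      unfolding ind_def by (intro sum.cong refl abs_l2_scaleC[symmetric] sq)
    also have "\<dots> \<in> ?W"
      using ind_in_closure[OF m] W by (intro csubspace_sum[OF W]) (auto simp: csubspace_def)
    finally show ?thesis .
  qed
  have "u \<in> ?W" for u
  proof -
    obtain f where f: "sq_integrable haar f" "u = abs_l2 f" by (rule l2_cases)
    then have fm [measurable]: "f \<in> borel_measurable haar" and fi: "integrable haar (\<lambda>x. (cmod (f x))\<^sup>2)"
      by (auto simp: sq_integrable_def)
    from borel_measurable_implies_sequence_metric[OF fm, of 0] obtain s where
      s: "\<And>i. simple_function haar (s i)" "\<And>x. (\<lambda>i. s i x) \<longlonglongrightarrow> f x"
        "\<And>i x. cmod (s i x) \<le> 2 * cmod (f x)"
      by auto
    have sm [measurable]: "s i \<in> borel_measurable haar" for i by (rule borel_measurable_simple_function[OF s(1)])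
    have le: "(cmod (s i x))\<^sup>2 \<le> 4 * (cmod (f x))\<^sup>2" for i x
      using power_mono[OF s(3)[of i x], of 2] by (simp add: power_mult_distrib)
    \<comment> \<open>The approximants are bounded by twice \<open>f\<close>, so the constant is (2
      + 1)^2.\<close>
    have le': "(cmod (s i x - f x))\<^sup>2 \<le> 9 * (cmod (f x))\<^sup>2" for i x
    proof -
      have "cmod (s i x - f x) \<le> 3 * cmod (f x)"
        using norm_triangle_ineq4[of "s i x" "f x"] s(3)[of i x] by linarith
      from power_mono[OF this, of 2] show ?thesis by (simp add: power_mult_distrib)
    qed
    have sq: "sq_integrable haar (s i)" for i
    proof -
      have "integrable haar (\<lambda>x. (cmod (s i x))\<^sup>2)"
        by (rule Bochner_Integration.integrable_bound[OF integrable_mult_right[OF fi, of 4]]) (use le in auto)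
      then show ?thesis by (simp add: sq_integrable_def sm)
    qed
    have "(\<lambda>i. \<integral>x. (cmod (s i x - f x))\<^sup>2 \<partial>haar) \<longlonglongrightarrow> (\<integral>x. 0 \<partial>(haar :: 'g measure))"
    proof (rule integral_dominated_convergence[where w = "\<lambda>x. 9 * (cmod (f x))\<^sup>2"])
      show "AE x in haar. (\<lambda>i. (cmod (s i x - f x))\<^sup>2) \<longlonglongrightarrow> 0"
      proof (rule AE_I2)
        fix x
        have "(\<lambda>i. (cmod (s i x - f x))\<^sup>2) \<longlonglongrightarrow> (cmod (f x - f x))\<^sup>2"
          by (intro tendsto_intros s(2))
        then show "(\<lambda>i. (cmod (s i x - f x))\<^sup>2) \<longlonglongrightarrow> 0" by simp
      qed
    qed (use fi le' in auto)
    then have "(\<lambda>i. (norm (abs_l2 (s i) - u))\<^sup>2) \<longlonglongrightarrow> 0"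
      by (simp add: f abs_l2_diff sq norm_abs_l2 sq_integrable_minus)
    from tendsto_real_sqrt[OF this] have "(\<lambda>i. norm (abs_l2 (s i) - u)) \<longlonglongrightarrow> 0" by simp
    then have "(\<lambda>i. abs_l2 (s i)) \<longlonglongrightarrow> u"
      by (rule LIM_zero_cancel[OF tendsto_norm_zero_cancel])
    with simple[OF s(1)] show "u \<in> ?W" by (rule closed_sequentially[OF closed_closure])
  qed
  then show ?thesis by blast
qed

end


section \<open>Equivariant spectral triples\<close>

text \<open>The sets are listed one after another, \<open>F k\<close> starting at position
  \<open>m k\<close>. Nonemptiness makes \<open>m\<close> strictly increasing, hence unbounded, so
  each position belongs to a block; an element of several sets is listed once for each.\<close>

lemma ex_layered_enumeration:
  fixes F :: "nat \<Rightarrow> 'a set"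
  assumes fin: "\<And>k. finite (F k)" and ne: "\<And>k. F k \<noteq> {}"
  obtains g m L where "strict_mono m" "\<And>i::nat. m (L i) \<le> i \<and> i < (m (Suc (L i)) :: nat)"
    "\<And>k. g ` {m k..<m (Suc k)} = F k"
proof -
  define m where "m k = (\<Sum>l<k. card (F l))" for k
  have Suc: "m (Suc k) = m k + card (F k)" for k by (simp add: m_def)
  have m: "strict_mono m"
    using fin ne by (simp add: strict_mono_Suc_iff Suc card_gt_0_iff)
  define L where "L i = (LEAST k. i < m (Suc k))" for i
  have L1: "i < m (Suc (L i))" for i
    unfolding L_def using strict_mono_imp_increasing[OF m, of "Suc i"]
    by (rule LeastI[of "\<lambda>k. i < m (Suc k)" i, OF Suc_le_lessD])
  have L2: "m (L i) \<le> i" for i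
  proof (cases "L i")
    case 0 then show ?thesis by (simp add: m_def)
  next
    case (Suc j)
    then have "\<not> i < m (Suc j)"
      using not_less_Least[of j "\<lambda>k. i < m (Suc k)"] by (simp add: L_def)
    then show ?thesis using Suc by simp
  qed
  have Leq: "L i = k" if "m k \<le> i" "i < m (Suc k)" for i k
  proof (rule antisym)
    show "L i \<le> k" unfolding L_def by (rule Least_le[of "\<lambda>k. i < m (Suc k)" k, OF that(2)])
    show "k \<le> L i"
    proof (rule ccontr)
      assume "\<not> k \<le> L i"
      then have "m (Suc (L i)) \<le> m k" using m by (simp add: strict_mono_less_eq)
      then show False using L1[of i] that(1) by simp
    qed
  qed
  have "\<forall>k. \<exists>h. bij_betw h {0..<card (F k)} (F k)" using ex_bij_betw_nat_finite[OF fin] by blast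
  then obtain h where h: "\<And>k. bij_betw (h k) {0..<card (F k)} (F k)" by metis
  define g where "g i = h (L i) (i - m (L i))" for i
  have "g ` {m k..<m (Suc k)} = F k" for k
  proof -
    have "g ` {m k..<m (Suc k)} = (\<lambda>i. h k (i - m k)) ` {m k..<m k + card (F k)}"
      using Leq[of k] by (intro image_cong) (auto simp: g_def Suc)
    also have "\<dots> = h k ` ((\<lambda>i. i - m k) ` {m k..<m k + card (F k)})" by (simp add: image_image)
    also have "(\<lambda>i. i - m k) ` {m k..<m k + card (F k)} = {0..<card (F k)}"
      by (auto simp: image_iff) (metis add_diff_cancel_left' le_add1 nat_add_left_cancel_less atLeastLessThan_iff)
    also have "h k ` \<dots> = F k" using h[of k] by (simp add: bij_betw_def)
    finally show ?thesis .
  qed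
  then show ?thesis using that[of m L g] m L1 L2 by blast
qed

context subgroup_filtration
begin

text \<open>Gram--Schmidt on the coset indicators, level by level: \<open>L i\<close> is the level
  of \<open>e i\<close>, which is orthogonal to all coarser layers. The last clause says that only
  finitely many indices have level below a given one; it will make the commutators
  finite-rank.\<close>

lemma ex_layered_dirac:
  "\<exists>(e :: nat \<Rightarrow> 'g l2) \<mu> (L :: nat \<Rightarrow> nat) m. dirac e \<mu> \<and> (\<forall>i j. L i = L j \<longrightarrow> \<mu> i = \<mu> j) \<and>
     (\<forall>i. e i \<in> layer (L i)) \<and> (\<forall>i k. \<forall>v\<in>layer k. k < L i \<longrightarrow> cinner (e i) v = 0) \<and>
     (\<forall>i k. m k \<le> i \<longrightarrow> k \<le> L i)"
proof -
  obtain g and m :: "nat \<Rightarrow> nat" and L where m: "strict_mono m" and L: "\<And>i. m (L i) \<le> i \<and> i < m (Suc (L i))"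
    and g: "\<And>k. g ` {m k..<m (Suc k)} = ind ` range (coset k)"
    by (rule ex_layered_enumeration[of "\<lambda>k. ind ` range (coset k)"]) (auto simp: finite_cosets)
  define e where "e = orthonormalize g"
  \<comment> \<open>The exponent exceeds every index of level \<open>k\<close>, so the powers of the
    eigenvalues are dominated by a geometric series.\<close>
  define \<nu> where "\<nu> k = (1/2::real) ^ m (Suc k)" for k
  have L_le: "k \<le> L i" if "m k \<le> i" for i k
  proof (rule ccontr)
    assume "\<not> k \<le> L i"
    then have "m (Suc (L i)) \<le> m k" using m by (simp add: strict_mono_less_eq)
    then show False using L[of i] that by simp
  qed
  have g_layer: "g i \<in> layer (L i)" for i
  proof -
    have "g i \<in> g ` {m (L i)..<m (Suc (L i))}" using L[of i] by simp
    then obtain x where x: "g i = ind (coset (L i) x)" unfolding g by blast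
    show ?thesis unfolding x by (rule ind_coset_in_layer)
  qed
  have L_mono: "L i \<le> L j" if "i \<le> j" for i j
    using L[of i] that by (intro L_le) simp
  have e_layer: "e i \<in> layer (L i)" for i
    unfolding e_def
  proof (rule orthonormalize_in_csubspace[OF csubspace_layer])
    fix j assume "j < Suc i"
    then show "g j \<in> layer (L i)" using g_layer[of j] layer_mono[OF L_mono[of j i]] by auto
  qed simp
  have layer_hull: "layer k \<subseteq> csubspace hull (e ` {..<m (Suc k)})" for k
  proof (rule order_trans[OF layer_subset_hull], rule hull_minimal)
    show "csubspace (csubspace hull (e ` {..<m (Suc k)}))" by (rule csubspace_hull)
    show "ind ` range (coset k) \<subseteq> csubspace hull (e ` {..<m (Suc k)})"
      unfolding g[symmetric]
    proof
      fix u assume "u \<in> g ` {m k..<m (Suc k)}"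
      then obtain i where i: "u = g i" "i < m (Suc k)" by auto
      have "csubspace hull (e ` {..i}) \<subseteq> csubspace hull (e ` {..<m (Suc k)})"
        using i(2) by (intro hull_mono) auto
      then show "u \<in> csubspace hull (e ` {..<m (Suc k)})"
        using in_hull_orthonormalize[of g i] i by (auto simp: e_def)
    qed
  qed
  have orth: "cinner (e i) v = 0" if "k < L i" "v \<in> layer k" for i k v
  proof -
    have "csubspace {v. cinner (e i) v = 0}"
      by (auto simp: csubspace_def cinner_add_right cinner_scaleC_right)
    moreover have "e ` {..<m (Suc k)} \<subseteq> {v. cinner (e i) v = 0}"
    proof
      fix u assume "u \<in> e ` {..<m (Suc k)}"
      then obtain j where j: "u = e j" "j < m (Suc k)" by auto
      have "m (Suc k) \<le> m (L i)" using that(1) m by (simp add: strict_mono_less_eq)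
      then have "j < i" using j L[of i] by linarith
      then show "u \<in> {v. cinner (e i) v = 0}" using orthonormalize_orth[of i j g] by (simp add: j e_def)
    qed
    ultimately have "csubspace hull (e ` {..<m (Suc k)}) \<subseteq> {v. cinner (e i) v = 0}"
      by (intro hull_minimal)
    then show ?thesis using layer_hull[of k] that(2) by blast
  qed
  have total: "closure (csubspace hull (range e)) = UNIV"
  proof -
    have "(\<Union>k. layer k) \<subseteq> csubspace hull (range e)"
    proof (rule UN_least)
      fix k
      have "csubspace hull (e ` {..<m (Suc k)}) \<subseteq> csubspace hull (range e)" by (intro hull_mono) auto
      then show "layer k \<subseteq> csubspace hull (range e)" using layer_hull[of k] by order
    qed
    from closure_mono[OF this] show ?thesis unfolding closure_UN_layer by auto
  qed
  have "dirac e (\<lambda>i. \<nu> (L i))"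
  proof
    show "i \<noteq> j \<Longrightarrow> cinner (e i) (e j) = 0" for i j
      unfolding e_def by (rule orthonormalize_orth)
    show "e i = 0 \<or> cinner (e i) (e i) = 1" for i
      unfolding e_def by (rule orthonormalize_unit)
    show "closure (csubspace hull (range e)) = UNIV" by (rule total)
    show "0 < \<nu> (L i)" for i by (simp add: \<nu>_def)
    show "summable (\<lambda>i. \<nu> (L i) powr s)" if "s > 0" for s
    proof (rule summable_comparison_test'[where N = 0])
      define q where "q = (1/2::real) powr s"
      have q: "0 < q" "q < 1" using that powr_less_mono2[of s "1/2" 1] by (auto simp: q_def)
      show "summable (\<lambda>i. q ^ i)" using q by (intro summable_geometric) simp
      fix i
      have "\<nu> (L i) powr s = q ^ m (Suc (L i))"
        by (simp add: \<nu>_def q_def powr_powr mult.commute flip: powr_realpow)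
      also have "\<dots> \<le> q ^ i" using q L[of i] by (intro power_decreasing) auto
      finally show "norm (\<nu> (L i) powr s) \<le> q ^ i" by simp
    qed
  qed
  then show ?thesis
    by (intro exI[of _ e] exI[of _ "\<lambda>i. \<nu> (L i)"] exI[of _ L] exI[of _ m])
       (simp add: e_layer orth L_le)
qed

text \<open>Both properties of \<open>D\<close> come from vanishing matrix entries between different
  levels. The operator is applied to the vector of coarser level, passing to the adjoint if that
  vector stands on the left.\<close>

theorem ex_equivariant_spectral_triple:
  assumes A: "\<And>f. f \<in> A \<Longrightarrow> \<exists>k. invariant k (f :: 'g \<Rightarrow> complex)"
  shows "\<exists>S D. spectral_triple A S D \<and> equivariant S D \<and> (\<forall>s>0. s_summable S D s)"
proof -
  obtain e :: "nat \<Rightarrow> 'g l2" and \<mu> and L m :: "nat \<Rightarrow> nat" where "dirac e \<mu>"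
    and \<mu>: "\<forall>i j. L i = L j \<longrightarrow> \<mu> i = \<mu> j" and layer': "\<forall>i. e i \<in> layer (L i)"
    and orth_L: "\<forall>i k. \<forall>v\<in>layer k. k < L i \<longrightarrow> cinner (e i) v = 0"
    and L': "\<forall>i k. m k \<le> i \<longrightarrow> k \<le> L i"
    using ex_layered_dirac by (elim exE conjE)
  note layer = layer'[rule_format] and L = L'[rule_format]
  have orth_layer: "cinner (e i) v = 0" if "k < L i" "v \<in> layer k" for i k v
    using orth_L that by blast
  interpret dirac e \<mu> by fact
  have orth_layer': "cinner v (e i) = 0" if "k < L i" "v \<in> layer k" for i k v
    using orth_layer[OF that] cinner_commute[of v "e i"] by simp
  have "equivariant (range T) D"
    unfolding equivariant_def
  proof (intro allI)
    fix x :: 'g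
    have block: "cinner (e i) (right_reg x (e j)) = 0" if "\<mu> i \<noteq> \<mu> j" for i j
    proof -
      have "L i \<noteq> L j" using that \<mu> by metis
      then consider "L j < L i" | "L i < L j" by linarith
      then show ?thesis
      proof cases
        case 1
        then show ?thesis using right_reg_layer[OF layer] by (rule orth_layer)
      next
        case 2
        \<comment> \<open>The coarser vector is \<open>e i\<close>, so the translation is moved to
          it.\<close>
        have "cinner (e i) (right_reg x (e j)) = cinner (right_reg (- x) (e i)) (e j)"
          using cinner_right_reg[of "- x" "e i" "e j"] by simp
        also have "\<dots> = 0" using 2 right_reg_layer[OF layer] by (rule orth_layer')
        finally show ?thesis .
      qed
    qed
    show "right_reg x ` range T \<subseteq> range T \<and> (\<forall>u\<in>range T. D (right_reg x u) = right_reg x (D u))"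
      using commute_D[OF bounded_op_right_reg block] by blast
  qed
  moreover have "spectral_triple A (range T) D"
    unfolding spectral_triple_def
  proof (intro conjI self_adjoint_D compact_resolvent_D ballI)
    fix f assume "f \<in> A"
    from A[OF this] obtain k where f: "invariant k f" by blast
    obtain B where B: "\<And>x. cmod (f x) \<le> B" using invariant_bounded[OF f] by blast
    have f': "invariant k (\<lambda>x. cnj (f x))" by (rule invariant_comp[OF f])
    \<comment> \<open>Indices from \<open>m (Suc k)\<close> on have level above \<open>k\<close>;
      only entries between two levels at most \<open>k\<close> may escape.\<close>
    have block: "cinner (e i) (mult_op f (e j)) = 0" if "m (Suc k) \<le> i \<or> m (Suc k) \<le> j" "\<mu> i \<noteq> \<mu> j" for i j
    proof -
      have "k < L i \<or> k < L j" using that(1) L[of "Suc k" i] L[of "Suc k" j] by auto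
      moreover have "L i \<noteq> L j" using that(2) \<mu> by metis
      \<comment> \<open>The larger of the two levels exceeds both \<open>k\<close> and the other
        level, and multiplication keeps the coarser vector in a layer strictly below it.\<close>
      ultimately consider "max k (L j) < L i" | "max k (L i) < L j" by linarith
      then show ?thesis
      proof cases
        case 1
        have "mult_op f (e j) \<in> layer (max k (L j))"
          using layer_mono[of "L j" "max k (L j)"] layer[of j]
          by (intro mult_op_layer invariant_mono[OF f]) auto
        with 1 show ?thesis by (rule orth_layer)
      next
        case 2
        have "mult_op (\<lambda>x. cnj (f x)) (e i) \<in> layer (max k (L i))"
          using layer_mono[of "L i" "max k (L i)"] layer[of i]
          by (intro mult_op_layer invariant_mono[OF f']) auto
        with 2 have "cinner (mult_op (\<lambda>x. cnj (f x)) (e i)) (e j) = 0" by (rule orth_layer')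
        moreover have "cinner (mult_op (\<lambda>x. cnj (f x)) (e i)) (e j) = cinner (e i) (mult_op f (e j))"
          using cinner_mult_op[OF invariant_measurable[OF f'], of B "e i" "e j"] B by simp
        ultimately show ?thesis by simp
      qed
    qed
    from bounded_commutator[OF bounded_op_mult_op[OF invariant_measurable[OF f] B] block]
    show "mult_op f ` range T \<subseteq> range T"
      "\<exists>C. bounded_op C \<and> (\<forall>u\<in>range T. C u = D (mult_op f u) - mult_op f (D u))"
      by blast+
  qed
  ultimately show ?thesis using s_summable_D by blast
qed

text \<open>There are no small subgroups in the unitary group: squaring a matrix close to the
  identity almost doubles its distance to the identity.\<close>

lemma unitary_rep_invariant:
  assumes \<rho>: "unitary_rep n \<rho>"
  obtains k where "\<And>i j. i < n \<Longrightarrow> j < n \<Longrightarrow> invariant k (\<lambda>x::'g. \<rho> x $$ (i, j))"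
proof -
  have carrier: "\<rho> x \<in> carrier_mat n n" and adj: "mat_adjoint (\<rho> x) * \<rho> x = 1\<^sub>m n"
    and hom: "\<rho> (x + y) = \<rho> x * \<rho> y" for x y
    using \<rho> by (auto simp: unitary_rep_def)
  have cont: "continuous_on UNIV (\<lambda>x. \<rho> x $$ (i, j))" if "i < n" "j < n" for i j
    using \<rho> that by (auto simp: unitary_rep_def)
  have mult: "\<rho> (x + y) $$ (i, j) = (\<Sum>k<n. \<rho> x $$ (i, k) * \<rho> y $$ (k, j))"
    if "i < n" "j < n" for x y i j
    using carrier[of x] carrier[of y] that
    by (simp add: hom scalar_prod_def atLeast0LessThan)
  define \<delta> where "\<delta> i j = (if i = j then 1 else 0 :: complex)" for i j :: nat
  define a where "a x i j = \<rho> x $$ (i, j) - \<delta> i j" for x i j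
  \<comment> \<open>The entrywise sum norm of \<open>\<rho> x - 1\<close>: it is submultiplicative,
    which is what the quadratic term below requires.\<close>
  define \<nu> where "\<nu> x = (\<Sum>i<n. \<Sum>j<n. cmod (a x i j))" for x
  \<comment> \<open>The homomorphism law only makes \<open>\<rho> 0\<close> idempotent; cancelling
    one factor by unitarity leaves the identity.\<close>
  have "\<rho> 0 = 1\<^sub>m n"
  proof -
    have M: "mat_adjoint (\<rho> 0) \<in> carrier_mat n n" using carrier[of 0] by (auto simp: mat_adjoint_def intro!: carrier_matI)
    have "1\<^sub>m n = mat_adjoint (\<rho> 0) * (\<rho> 0 * \<rho> 0)"
      using adj[of 0] hom[of 0 0] by simp
    also have "\<dots> = (mat_adjoint (\<rho> 0) * \<rho> 0) * \<rho> 0"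
      using M carrier[of 0] by (simp add: assoc_mult_mat)
    also have "\<dots> = \<rho> 0" using adj[of 0] carrier[of 0] by simp
    finally show ?thesis ..
  qed
  then have \<nu>0: "\<nu> 0 = 0" by (simp add: \<nu>_def a_def \<delta>_def)
  have "continuous_on UNIV \<nu>"
    unfolding \<nu>_def a_def using cont by (intro continuous_intros) auto
  then have "open {h. \<nu> h < 1/2}" by (intro open_Collect_less continuous_on_const)
  from base_N[OF this] \<nu>0 obtain k where k: "N k \<subseteq> {h. \<nu> h < 1/2}" by auto
  have aij: "cmod (a x i j) \<le> \<nu> x" if "i < n" "j < n" for x i j
  proof -
    have "cmod (a x i j) \<le> (\<Sum>j<n. cmod (a x i j))" using that by (intro member_le_sum) auto
    also have "\<dots> \<le> \<nu> x" unfolding \<nu>_def using that by (intro member_le_sum) (auto intro: sum_nonneg)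
    finally show ?thesis .
  qed
  \<comment> \<open>With \<open>a = \<rho> h - 1\<close> this is the triangle inequality for 2 a =
    ((1 + a)^2 - 1) - a^2.\<close>
  have double: "2 * \<nu> h \<le> \<nu> (h + h) + \<nu> h * \<nu> h" for h
  proof -
    have eq: "2 * a h i j = a (h + h) i j - (\<Sum>k<n. a h i k * a h k j)" if "i < n" "j < n" for i j
    proof -
      have "\<rho> (h + h) $$ (i, j) = (\<Sum>k<n. (a h i k + \<delta> i k) * (a h k j + \<delta> k j))"
        using mult[OF that, of h h] by (simp add: a_def)
      also have "\<dots> = (\<Sum>k<n. a h i k * a h k j + (if k = j then a h i j else 0)
          + (if k = i then a h i j else 0) + (if k = i then \<delta> i j else 0))"
        by (intro sum.cong refl) (auto simp: \<delta>_def algebra_simps)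
      also have "\<dots> = (\<Sum>k<n. a h i k * a h k j) + a h i j + a h i j + \<delta> i j"
        using that by (simp add: sum.distrib)
      finally show ?thesis by (simp add: a_def)
    qed
    have "2 * \<nu> h = (\<Sum>i<n. \<Sum>j<n. cmod (2 * a h i j))"
      by (simp add: \<nu>_def sum_distrib_left norm_mult)
    also have "\<dots> \<le> (\<Sum>i<n. \<Sum>j<n. cmod (a (h + h) i j) + (\<Sum>k<n. cmod (a h i k) * cmod (a h k j)))"
    proof (intro sum_mono)
      fix i j assume "i \<in> {..<n}" "j \<in> {..<n}"
      then have "cmod (2 * a h i j) = cmod (a (h + h) i j - (\<Sum>k<n. a h i k * a h k j))"
        by (simp only: eq lessThan_iff)
      also have "\<dots> \<le> cmod (a (h + h) i j) + cmod (\<Sum>k<n. a h i k * a h k j)"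
        by (rule norm_triangle_ineq4)
      also have "cmod (\<Sum>k<n. a h i k * a h k j) \<le> (\<Sum>k<n. cmod (a h i k) * cmod (a h k j))"
        by (rule order_trans[OF norm_sum]) (simp add: norm_mult)
      finally show "cmod (2 * a h i j) \<le> cmod (a (h + h) i j) + (\<Sum>k<n. cmod (a h i k) * cmod (a h k j))"
        by simp
    qed
    also have "\<dots> = \<nu> (h + h) + (\<Sum>i<n. \<Sum>j<n. \<Sum>k<n. cmod (a h i k) * cmod (a h k j))"
      by (simp add: \<nu>_def sum.distrib)
    also have "(\<Sum>i<n. \<Sum>j<n. \<Sum>k<n. cmod (a h i k) * cmod (a h k j))
        = (\<Sum>i<n. \<Sum>k<n. cmod (a h i k) * (\<Sum>j<n. cmod (a h k j)))"
      by (simp add: sum_distrib_left) (intro sum.cong refl sum.swap)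
    also have "\<dots> \<le> (\<Sum>i<n. \<Sum>k<n. cmod (a h i k) * \<nu> h)"
    proof (intro sum_mono mult_left_mono)
      fix k assume "k \<in> {..<n}"
      then show "(\<Sum>j<n. cmod (a h k j)) \<le> \<nu> h"
        unfolding \<nu>_def by (intro member_le_sum[of k "{..<n}" "\<lambda>i. \<Sum>j<n. cmod (a h i j)"]) (auto intro: sum_nonneg)
    qed auto
    also have "\<dots> = \<nu> h * \<nu> h" by (simp add: \<nu>_def sum_distrib_right)
    finally show ?thesis by simp
  qed
  \<comment> \<open>As \<open>\<nu> h < 1/2\<close> on \<open>N k\<close>, \<open>double\<close>
    gives that 3/2 times \<open>\<nu> h\<close> is at most \<open>\<nu> (h + h)\<close>. Since
    \<open>h + h\<close> stays in the subgroup, this can be iterated.\<close>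
  have bound: "\<nu> h \<le> (2/3) ^ p" if "h \<in> N k" for h p
    using that
  proof (induction p arbitrary: h)
    case 0
    then have "\<nu> h < 1/2" using k by auto
    then show ?case by simp
  next
    case (Suc p)
    have "\<nu> (h + h) \<le> (2/3) ^ p" by (intro Suc.IH add_N Suc.prems)
    moreover have "\<nu> h < 1/2" using Suc.prems k by auto
    moreover have "\<nu> h \<ge> 0" unfolding \<nu>_def by (intro sum_nonneg) auto
    ultimately have "\<nu> h * \<nu> h \<le> \<nu> h * (1/2)" by (intro mult_left_mono) auto
    then show ?case using double[of h] \<open>\<nu> (h + h) \<le> (2/3) ^ p\<close> by simp
  qed
  have \<rho>N: "\<rho> h $$ (i, j) = \<delta> i j" if "h \<in> N k" "i < n" "j < n" for h i j
  proof -
    have "(\<lambda>p. (2/3::real) ^ p) \<longlonglongrightarrow> 0" by (intro LIMSEQ_power_zero) simp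
    then have "cmod (a h i j) \<le> 0"
      using order_trans[OF aij[OF that(2,3)] bound[OF that(1)]]
      by (intro LIMSEQ_le_const[of "\<lambda>p. (2/3::real) ^ p" 0]) auto
    then show ?thesis by (simp add: a_def)
  qed
  show thesis
  proof (rule that[of k])
    fix i j assume ij: "i < n" "j < n"
    show "invariant k (\<lambda>x. \<rho> x $$ (i, j))"
      unfolding invariant_def
    proof (intro allI ballI)
      fix x h assume h: "h \<in> N k"
      have "\<rho> (x + h) $$ (i, j) = (\<Sum>l<n. if l = j then \<rho> x $$ (i, j) else 0)"
        unfolding mult[OF ij] using ij h by (intro sum.cong refl) (auto simp: \<rho>N \<delta>_def)
      then show "\<rho> (x + h) $$ (i, j) = \<rho> x $$ (i, j)" using ij by simp
    qed
  qed
qed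

lemma representative_function_invariant:
  "(f :: 'g \<Rightarrow> complex) \<in> representative_functions \<Longrightarrow> \<exists>k. invariant k f"
proof (induction rule: representative_functions.induct)
  case (entry n \<rho> i j)
  then show ?case using unitary_rep_invariant by metis
next
  case (add f g)
  then obtain k l where "invariant k f" "invariant l g" by blast
  then have "invariant (max k l) f" "invariant (max k l) g" using invariant_mono by (meson max.cobounded1 max.cobounded2)+
  from invariant_comp2[OF this, of "(+)"] show ?case by blast
next
  case (scale f c)
  then obtain k where "invariant k f" by blast
  from invariant_comp[OF this, of "\<lambda>y. c * y"] show ?case by blast
next
  case (mult f g)
  then obtain k l where "invariant k f" "invariant l g" by blast
  then have "invariant (max k l) f" "invariant (max k l) g" using invariant_mono by (meson max.cobounded1 max.cobounded2)+
  from invariant_comp2[OF this, of "times"] show ?case by blast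
next
  case (star f)
  then obtain k where "invariant k f" by blast
  from invariant_comp[OF this, of cnj] show ?case by blast
qed

text \<open>Setting \<open>x = 0\<close> in the decomposition exhibits \<open>f\<close> itself as a
  finite combination of representative functions.\<close>

lemma smooth_algebra_invariant:
  assumes "(f :: 'g \<Rightarrow> complex) \<in> smooth_algebra"
  shows "\<exists>k. invariant k f"
proof -
  obtain n :: nat and a b where b: "\<forall>k<n. continuous_on UNIV (a k) \<and> b k \<in> representative_functions"
    and f: "\<forall>x y. f (x + y) = (\<Sum>k<n. a k x * b k y)"
    using assms unfolding smooth_algebra_def by blast
  have "\<forall>k<n. \<exists>l. invariant l (b k)" using b representative_function_invariant by blast
  then obtain l where l: "\<And>k. k < n \<Longrightarrow> invariant (l k) (b k)" by metis
  \<comment> \<open>The sum of the levels serves as a common upper bound, also when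
    \<open>n = 0\<close>.\<close>
  have "invariant (\<Sum>k<n. l k) (b k)" if "k < n" for k
    using that by (intro invariant_mono[OF l] member_le_sum) auto
  moreover have "f y = (\<Sum>k<n. a k 0 * b k y)" for y using f[rule_format, of 0 y] by simp
  ultimately have "invariant (\<Sum>k<n. l k) f" by (simp add: invariant_def)
  then show ?thesis by blast
qed

end

section \<open>Open normal subgroups of a compact totally disconnected group\<close>

lemma ex_open_normal_subgroup:
  assumes comp: "compact (UNIV :: 'g::topological_group_add set)"
    and disc: "\<forall>x::'g. connected_component_set UNIV x = {x}"
    and haus: "Hausdorff_space (euclidean :: 'g topology)"
    and W: "open W" "(0::'g) \<in> W"
  shows "\<exists>H. open H \<and> 0 \<in> H \<and> H \<subseteq> W \<and> (\<forall>x\<in>H. \<forall>y\<in>H. x + y \<in> H) \<and> (\<forall>x\<in>H. - x \<in> H)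
      \<and> (\<forall>x\<in>H. \<forall>y. y + x - y \<in> H)"
proof -
  have "compact_space (euclidean :: 'g topology)" using comp by (simp add: compact_space_def)
  then have "locally_compact_space (euclidean :: 'g topology)"
    by (rule compact_imp_locally_compact_space)
  moreover have "{0::'g} \<in> connected_components_of euclidean"
  proof -
    have "connected_component_of_set euclidean (0::'g) = connected_component_set UNIV 0"
      by (auto simp: connected_component_of_def connected_component_def)
    then show ?thesis unfolding connected_components_of_def using disc by auto
  qed
  \<comment> \<open>In a locally compact Hausdorff space a compact component has arbitrarily small
    clopen neighbourhoods; here the component is \<open>{0}\<close>.\<close>
  ultimately obtain U V where UV: "open U" "open V" "disjnt U V" "U \<union> V = UNIV" "0 \<in> U" "U \<subseteq> W"
    using wilder_locally_compact_component_thm[of euclidean "{0::'g}" W] haus W by auto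
  \<comment> \<open>The elements that can be inserted between any two summands without affecting
    membership in the clopen set \<open>U\<close>. Two-sided insertion makes this a normal subgroup
    at once, because conjugating elements are absorbed into \<open>x\<close> and \<open>y\<close>;
    taking both to be 0 shows that it lies in \<open>U\<close>.\<close>
  define H where "H = {h. \<forall>x y. x + h + y \<in> U \<longleftrightarrow> x + y \<in> U}"
  have H: "x + h + y \<in> U \<longleftrightarrow> x + y \<in> U" if "h \<in> H" for h x y using that by (auto simp: H_def)
  have "open H"
    unfolding open_subopen[of H]
  proof
    fix h assume h: "h \<in> H"
    \<comment> \<open>The triples for which insertion preserves membership form an open set because
      \<open>U\<close> and its complement \<open>V\<close> are both open; compactness of the space
      of pairs then gives a neighbourhood of \<open>h\<close> that works for all \<open>x\<close>
      and \<open>y\<close> at once.\<close>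
    let ?P = "{(h, x, y). x + h + y \<in> U \<and> x + y \<in> U} \<union> {(h, x, y). x + h + y \<in> V \<and> x + y \<in> V}"
    have "open {(h::'g, x, y). x + h + y \<in> A \<and> x + y \<in> A}" if "open A" for A
    proof -
      have "{(h::'g, x, y). x + h + y \<in> A \<and> x + y \<in> A}
          = (\<lambda>p. fst (snd p) + fst p + snd (snd p)) -` A \<inter> (\<lambda>p. fst (snd p) + snd (snd p)) -` A"
        by auto
      then show ?thesis using that by (auto intro!: open_Int open_vimage continuous_intros)
    qed
    then have P: "open ?P" using UV by (intro open_Un) auto
    have mem: "(h', x, y) \<in> ?P \<longleftrightarrow> (x + h' + y \<in> U \<longleftrightarrow> x + y \<in> U)" for h' x y
      using UV(3,4) by (auto simp: disjnt_iff)
    have "(h, x, y) \<in> ?P" for x y unfolding mem by (rule H[OF h])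
    then have sub: "{h} \<times> (UNIV \<times> UNIV) \<subseteq> ?P" by blast
    from Elementary_Topology.tube_lemma[OF compact_Times[OF comp comp] P sub]
    obtain X where X: "h \<in> X" "open X" "X \<times> (UNIV \<times> UNIV) \<subseteq> ?P"
      by (elim exE conjE)
    have "X \<subseteq> H"
    proof
      fix h' assume "h' \<in> X"
      then have "(h', x, y) \<in> ?P" for x y by (intro subsetD[OF X(3)]) simp
      then show "h' \<in> H" unfolding mem H_def by blast
    qed
    then show "\<exists>T. open T \<and> h \<in> T \<and> T \<subseteq> H" using X by blast
  qed
  moreover have "0 \<in> H" by (simp add: H_def)
  moreover have "H \<subseteq> W"
  proof
    fix h assume "h \<in> H"
    from H[OF this, of 0 0] show "h \<in> W" using UV by auto
  qed
  moreover have "h + h' \<in> H" if h: "h \<in> H" "h' \<in> H" for h h'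
    using H[OF h(2), of "_ + h"] H[OF h(1)] by (simp add: H_def add.assoc)
  moreover have "- h \<in> H" if h: "h \<in> H" for h
    unfolding H_def
  proof (intro CollectI allI)
    fix x y
    show "x + - h + y \<in> U \<longleftrightarrow> x + y \<in> U" using H[OF h, of "x + - h" y] by (simp add: add.assoc)
  qed
  moreover have "z + h - z \<in> H" if h: "h \<in> H" for h z
    unfolding H_def
  proof (intro CollectI allI)
    fix x y
    show "x + (z + h - z) + y \<in> U \<longleftrightarrow> x + y \<in> U"
      using H[OF h, of "x + z" "- z + y"] by (simp only: diff_conv_add_uminus add.assoc) (simp add: add.assoc[symmetric])
  qed
  ultimately show ?thesis by (intro exI[of _ H]) simp
qed

section \<open>The filtration and the spectral dimension\<close>

lemma ex_subgroup_filtration: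
  assumes comp: "compact (UNIV :: 'g::topological_group_add set)"
    and disc: "\<forall>x::'g. connected_component_set UNIV x = {x}"
    and metr: "metrizable_space (euclidean :: 'g topology)"
  shows "\<exists>N :: nat \<Rightarrow> 'g set. subgroup_filtration N"
proof -
  have haus: "Hausdorff_space (euclidean :: 'g topology)" by (rule metrizable_imp_Hausdorff_space[OF metr])
  have "\<exists>\<B>::'g set set. countable \<B> \<and> (\<forall>V\<in>\<B>. open V) \<and>
      (\<forall>U. open U \<and> 0 \<in> U \<longrightarrow> (\<exists>V\<in>\<B>. 0 \<in> V \<and> V \<subseteq> U))"
    using metrizable_imp_first_countable[OF metr] by (simp add: first_countable_def)
  then obtain \<B> :: "'g set set" where \<B>: "countable \<B>" "\<forall>V\<in>\<B>. open V"
    "\<forall>U. open U \<and> 0 \<in> U \<longrightarrow> (\<exists>V\<in>\<B>. 0 \<in> V \<and> V \<subseteq> U)"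
    by (elim exE conjE)
  \<comment> \<open>Members of the countable family that miss 0 are replaced by the whole group, so
    every \<open>W i\<close> is a neighbourhood of 0.\<close>
  define W where "W i = (if 0 \<in> from_nat_into \<B> i then from_nat_into \<B> i else UNIV)" for i
  have "\<B> \<noteq> {}" using \<B>(3)[rule_format, of UNIV] by auto
  then have W: "open (W i)" "0 \<in> W i" for i
    using \<B>(2) from_nat_into[OF \<open>\<B> \<noteq> {}\<close>, of i] by (auto simp: W_def)
  have "\<forall>i. \<exists>H. open H \<and> 0 \<in> H \<and> H \<subseteq> W i \<and> (\<forall>x\<in>H. \<forall>y\<in>H. x + y \<in> H) \<and> (\<forall>x\<in>H. - x \<in> H)
      \<and> (\<forall>x\<in>H. \<forall>y. y + x - y \<in> H)"
    by (intro allI ex_open_normal_subgroup[OF comp disc haus W])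
  then obtain H where H: "\<And>i. open (H i)" "\<And>i. 0 \<in> H i" "\<And>i. H i \<subseteq> W i"
    "\<And>i x y. x \<in> H i \<Longrightarrow> y \<in> H i \<Longrightarrow> x + y \<in> H i" "\<And>i x. x \<in> H i \<Longrightarrow> - x \<in> H i"
    "\<And>i x y. x \<in> H i \<Longrightarrow> y + x - y \<in> H i"
    by metis
  \<comment> \<open>Finite intersections make the sequence decreasing while keeping its members
    open.\<close>
  have "subgroup_filtration (\<lambda>k. \<Inter>i\<le>k. H i)"
  proof
    show "decseq (\<lambda>k. \<Inter>i\<le>k. H i)" by (intro antimonoI INT_anti_mono) auto
    fix U :: "'g set" assume U: "open U" "0 \<in> U"
    then obtain V where V: "V \<in> \<B>" "0 \<in> V" "V \<subseteq> U" using \<B>(3) by blast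
    then obtain k where "V = from_nat_into \<B> k"
      using from_nat_into_surj[OF \<B>(1)] by metis
    then have "W k = V" using V by (simp add: W_def)
    then have "(\<Inter>i\<le>k. H i) \<subseteq> U" using H(3)[of k] V by auto
    then show "\<exists>k. (\<Inter>i\<le>k. H i) \<subseteq> U" by blast
  qed (use comp H in auto)
  then show ?thesis by blast
qed

theorem corollary3p9:
  assumes "compact (UNIV :: 'g::topological_group_add set)"
    and "\<forall>x::'g. connected_component_set UNIV x = {x}"
    and "metrizable_space (euclidean :: 'g topology)"
  shows "spectral_dim TYPE('g) = 0"
proof -
  obtain N :: "nat \<Rightarrow> 'g set" where "subgroup_filtration N"
    using ex_subgroup_filtration[OF assms] by blast
  then interpret subgroup_filtration N .
  obtain S and D :: "'g l2 \<Rightarrow> 'g l2" where D: "spectral_triple smooth_algebra S D" "equivariant S D"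
    "\<And>s. s > 0 \<Longrightarrow> s_summable S D s"
    using ex_equivariant_spectral_triple[OF smooth_algebra_invariant] by blast
  let ?A = "{ereal s | s. s > 0 \<and> (\<exists>(S :: 'g l2 set) D.
    spectral_triple smooth_algebra S D \<and> equivariant S D \<and> s_summable S D s)}"
  have mem: "ereal s \<in> ?A" if "s > 0" for s using D that by blast
  have "Inf ?A \<le> 0"
  proof (rule ereal_le_epsilon2)
    fix s :: real assume "s > 0"
    from Inf_lower[OF mem[OF this]] show "Inf ?A \<le> 0 + ereal s" by simp
  qed
  moreover have "0 \<le> Inf ?A" by (intro Inf_greatest) auto
  ultimately show ?thesis unfolding spectral_dim_def by (rule antisym)
qed

end
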